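(* Let $\boldsymbol\lambda = (\lambda_{i})_{i\in\mathbb N}$ and $\boldsymbol d = (d_{i})_{i\in\mathbb N}$ be real sequences converging to $0$ such that \[\sum_{\lambda_i<0} |\lambda_i| = \sum_{\lambda_i>0} \lambda_i =\infty\] and \[\delta(\alpha,\boldsymbol\lambda, \boldsymbol d)\geq 0\quad\text{for all }\alpha\in\mathbb R\setminus\{0\}.\] Let \[\sigma_-=\liminf_{\alpha\nearrow 0}\delta(\alpha,\boldsymbol\lambda, \boldsymbol d), \qquad \sigma_+= \liminf_{\alpha\searrow 0}\delta(\alpha,\boldsymbol\lambda, \boldsymbol d).\] Suppose that the following four conditions hold: (a) $\sigma_- + \sigma_+>0$; (b) if $\sigma_-=0$ or $\sigma_+=0$, then $\#\{i : \lambda_{i}=0\}\geq \#\{i : d_{i} = 0\}$; (c) $\sum_{d_i>0} d_i =\infty$ or $\sigma_- =\infty$; (d) $\sum_{d_i<0} |d_i| =\infty$ or $\sigma_+ =\infty$. If $E$ is a self-adjoint operator with diagonal $\boldsymbol\lambda$, then $\boldsymbol d$ is also a diagonal of $E$.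
   Context: For real sequences $\boldsymbol\lambda$ and $\boldsymbol d$ converging to $0$ and $\alpha\in\mathbb R\setminus\{0\}$, \[\delta(\alpha,\boldsymbol\lambda,\boldsymbol{d}) = \begin{cases} \displaystyle\sum_{i:\lambda_{i}\geq\alpha}(\lambda_{i}-\alpha)-\sum_{i:d_{i}\geq\alpha}(d_{i}-\alpha) & \alpha>0,\\ \displaystyle\sum_{i:\lambda_{i}\leq\alpha}(\alpha-\lambda_{i})-\sum_{i:d_{i}\leq\alpha}(\alpha-d_{i}) & \alpha<0. \end{cases}\] The values $\sigma_\pm$ lie in $[0,\infty]$ and cardinalities $\#$ in $\{0\}\cup\mathbb N\cup\{\infty\}$. Operators are bounded linear operators on a separable Hilbert space $\mathcal H$. A real family $(c_i)_{i\in I}$ is a diagonal of a self-adjoint operator $E$ on $\mathcal H$ if there is an orthonormal basis $(e_i)_{i\in I}$ of $\mathcal H$ with $\langle Ee_i,e_i\rangle=c_i$ for all $i\in I$. *)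

theory Defs
  imports "HOL-Analysis.Analysis" "HOL-Library.Extended_Nat"
begin

text \<open>
  Complex inner product spaces, as an extension of the library's real ones: the real inner product
  is the real part of the complex one, so norm, metric, topology and completeness are
  those of the class \<open>real_inner\<close>. The form \<open>cinner\<close> is linear in its first argument.
  Positive definiteness of \<open>cinner\<close> follows from that of \<open>inner\<close>, because
  \<open>cinner x x\<close> is real by conjugate symmetry.
\<close>

class complex_inner = real_inner +
  fixes scaleC :: "complex \<Rightarrow> 'a \<Rightarrow> 'a"  (infixr "*\<^sub>C" 75)
    and cinner :: "'a \<Rightarrow> 'a \<Rightarrow> complex"
  assumes scaleC_add_right: "a *\<^sub>C (x + y) = a *\<^sub>C x + a *\<^sub>C y"
    and scaleC_add_left: "(a + b) *\<^sub>C x = a *\<^sub>C x + b *\<^sub>C x"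
    and scaleC_scaleC: "a *\<^sub>C b *\<^sub>C x = (a * b) *\<^sub>C x"
    and scaleR_scaleC: "r *\<^sub>R x = complex_of_real r *\<^sub>C x"
    and cinner_commute: "cinner x y = cnj (cinner y x)"
    and cinner_add_left: "cinner (x + y) z = cinner x z + cinner y z"
    and cinner_scaleC_left: "cinner (a *\<^sub>C x) y = a * cinner x y"
    and inner_eq_Re_cinner: "inner x y = Re (cinner x y)"

class complex_hilbert_space = complex_inner + complete_space

global_interpretation cvec: vector_space "scaleC :: complex \<Rightarrow> 'a \<Rightarrow> 'a::complex_inner"
proof
  fix x :: 'a
  show "1 *\<^sub>C x = x"
    using scaleR_scaleC[of 1 x] by simp
qed (simp_all add: scaleC_add_right scaleC_add_left scaleC_scaleC)

definition bounded_operator :: "('h::complex_inner \<Rightarrow> 'h) \<Rightarrow> bool" where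
  "bounded_operator E \<longleftrightarrow> bounded_linear E \<and> (\<forall>a x. E (a *\<^sub>C x) = a *\<^sub>C E x)"

definition selfadjoint_operator :: "('h::complex_inner \<Rightarrow> 'h) \<Rightarrow> bool" where
  "selfadjoint_operator E \<longleftrightarrow>
     bounded_operator E \<and> (\<forall>x y. cinner (E x) y = cinner x (E y))"

text \<open>The index set of the families below is the whole type \<open>'i\<close>.\<close>

definition orthonormal_basis :: "('i \<Rightarrow> 'h::complex_inner) \<Rightarrow> bool" where
  "orthonormal_basis e \<longleftrightarrow>
     (\<forall>i j. cinner (e i) (e j) = (if i = j then 1 else 0)) \<and>
     closure (cvec.span (range e)) = UNIV"

definition is_diagonal :: "('i \<Rightarrow> real) \<Rightarrow> ('h::complex_inner \<Rightarrow> 'h) \<Rightarrow> bool" where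
  "is_diagonal c E \<longleftrightarrow>
     (\<exists>e. orthonormal_basis e \<and> (\<forall>i. cinner (E (e i)) (e i) = complex_of_real (c i)))"

text \<open>
  For sequences tending to \<open>0\<close> and \<open>\<alpha> \<noteq> 0\<close> all index sets below are finite, so the sums are
  genuine. The value at \<open>\<alpha> = 0\<close> is meaningless.
\<close>

definition delta :: "real \<Rightarrow> (nat \<Rightarrow> real) \<Rightarrow> (nat \<Rightarrow> real) \<Rightarrow> real" where
  "delta \<alpha> l d =
     (if \<alpha> > 0
      then (\<Sum>i | l i \<ge> \<alpha>. l i - \<alpha>) - (\<Sum>i | d i \<ge> \<alpha>. d i - \<alpha>)
      else (\<Sum>i | l i \<le> \<alpha>. \<alpha> - l i) - (\<Sum>i | d i \<le> \<alpha>. \<alpha> - d i))"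

definition sigma_minus :: "(nat \<Rightarrow> real) \<Rightarrow> (nat \<Rightarrow> real) \<Rightarrow> ereal" where
  "sigma_minus l d = Liminf (at_left 0) (\<lambda>\<alpha>. ereal (delta \<alpha> l d))"

definition sigma_plus :: "(nat \<Rightarrow> real) \<Rightarrow> (nat \<Rightarrow> real) \<Rightarrow> ereal" where
  "sigma_plus l d = Liminf (at_right 0) (\<lambda>\<alpha>. ereal (delta \<alpha> l d))"

text \<open>Sums of the positive terms and of the absolute values of the negative terms, in \<open>[0,\<infinity>]\<close>.\<close>

definition pos_sum :: "(nat \<Rightarrow> real) \<Rightarrow> ennreal" where
  "pos_sum c = (\<Sum>\<^sub>\<infinity>i\<in>{i. c i > 0}. ennreal (c i))"

definition neg_sum :: "(nat \<Rightarrow> real) \<Rightarrow> ennreal" where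
  "neg_sum c = (\<Sum>\<^sub>\<infinity>i\<in>{i. c i < 0}. ennreal \<bar>c i\<bar>)"

definition ecard :: "'a set \<Rightarrow> enat" where
  "ecard A = (if finite A then enat (card A) else \<infinity>)"

end

theory Submission
  imports Defs
begin

text \<open>
  Rotating two members of an orthonormal family changes only their two diagonal entries, and with a
  suitable phase the new entries are any prescribed convex combinations of the old ones with
  the same sum. So only diagonal entries matter, and the task is to reach \<open>d\<close> from
  \<open>l\<close> by infinitely many such moves without losing completeness.

  For strictly positive decreasing sequences whose partial sums satisfy \<open>\<Sum>l \<ge> \<Sum>d\<close>,
  one vector is carried along: each step combines it with an unused vector so as to finish the next
  entry of \<open>d\<close>. The finished vectors are complete as soon as the carried values come
  arbitrarily close to \<open>0\<close>, which is arranged by first permuting \<open>l\<close> so that the partial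
  sums of \<open>l\<close> and \<open>d\<close> come arbitrarily close infinitely often.

  The positive and negative parts are treated separately. Before that, a positive \<open>\<sigma>\<close> leaves
  room to trade zero entries against small nonzero ones, and if \<open>\<sigma>\<^sub>- = \<sigma>\<^sub>+ = \<infinity>\<close> there is
  room to pull far-out pairs of entries of \<open>d\<close> apart until both parts of \<open>d\<close> are not
  summable.
\<close>

section \<open>Rotations of orthonormal families\<close>

text \<open>\<open>delta \<ge> 0\<close> is majorization in dual form:
  \<open>excess c \<alpha>\<close> is the maximum of the sums of \<open>c i - \<alpha>\<close> over
  finite index sets, so comparing excesses at all levels amounts to comparing sums of largest
  entries. Excesses need no sorting, separate the positive from the negative half of
  \<open>delta\<close>, and change in a controlled way when entries change a little. A move only
  brings entries closer together. So \<open>l\<close> may be contracted, whereas \<open>d\<close> is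
  first replaced by a more spread out sequence from which a contraction leads back. A chain of
  rotations on positive entries meets neither zeros nor negative entries, so it cannot create or
  absorb zeros. Hence the count (b), unless there is room on both sides, where a zero of
  \<open>d\<close> can be mixed from a positive and a negative entry. A chain with a surplus has to
  postpone it by drawing ever smaller entries of \<open>l\<close>, and the argument for this needs a
  divergent sum of \<open>d\<close>. Where \<open>d\<close> is summable, the surplus is instead
  cancelled against that of the other side, which is where (c) and (d) enter.\<close>

lemma cinner_add_right: "cinner x (y + z) = cinner x y + cinner x (z::'h::complex_inner)"
  by (metis cinner_add_left cinner_commute complex_cnj_add)

lemma cinner_scaleC_right: "cinner x (a *\<^sub>C y) = cnj a * cinner x (y::'h::complex_inner)"
  by (metis cinner_commute cinner_scaleC_left complex_cnj_mult)

lemma cinner_zero_left [simp]: "cinner 0 (x::'h::complex_inner) = 0"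
  using cinner_scaleC_left[of 0 x x] by (simp add: cvec.scale_zero_left)

lemma cinner_zero_right [simp]: "cinner (x::'h::complex_inner) 0 = 0"
  by (metis cinner_commute cinner_zero_left complex_cnj_zero)

lemma cinner_minus_left: "cinner (- x) (y::'h::complex_inner) = - cinner x y"
  using cinner_scaleC_left[of "-1" x y] by simp

lemma cinner_minus_right: "cinner (x::'h::complex_inner) (- y) = - cinner x y"
  by (metis cinner_commute cinner_minus_left complex_cnj_minus)

lemma cinner_diff_left: "cinner (x - y) (z::'h::complex_inner) = cinner x z - cinner y z"
  using cinner_add_left[of x "- y" z] by (simp add: cinner_minus_left)

lemma cinner_diff_right: "cinner (x::'h::complex_inner) (y - z) = cinner x y - cinner x z"
  using cinner_add_right[of x y "- z"] by (simp add: cinner_minus_right)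

lemmas cinner_sesquilinear =
  cinner_add_left cinner_add_right cinner_scaleC_left cinner_scaleC_right
  cinner_minus_left cinner_minus_right cinner_diff_left cinner_diff_right

lemma norm_scaleC: "norm (a *\<^sub>C x) = cmod a * norm (x::'h::complex_inner)"
proof -
  have "(norm (a *\<^sub>C x))\<^sup>2 = Re ((a * cnj a) * cinner x x)"
    by (simp add: power2_norm_eq_inner inner_eq_Re_cinner cinner_sesquilinear mult.assoc mult.commute mult.left_commute)
  also have "\<dots> = (cmod a)\<^sup>2 * Re (cinner x x)"
    by (simp add: complex_mult_cnj cmod_power2)
  also have "\<dots> = (cmod a * norm x)\<^sup>2"
    by (simp add: power_mult_distrib power2_norm_eq_inner inner_eq_Re_cinner)
  finally show ?thesis
    by (simp add: power2_eq_imp_eq)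
qed

lemma norm_unit: "cinner x (x::'h::complex_inner) = 1 \<Longrightarrow> norm x = 1"
  by (simp add: norm_eq_sqrt_inner inner_eq_Re_cinner)

section \<open>Closed complex spans and orthogonality\<close>

abbreviation closed_span :: "'h::complex_inner set \<Rightarrow> 'h set" where
  "closed_span A \<equiv> closure (cvec.span A)"

lemma subspace_closure:
  fixes S :: "'h::complex_inner set"
  assumes "cvec.subspace S"
  shows "cvec.subspace (closure S)"
proof (rule cvec.subspaceI)
  show "0 \<in> closure S"
    using assms closure_subset cvec.subspace_0 by blast
  show "x + y \<in> closure S" if "x \<in> closure S" "y \<in> closure S" for x y
  proof -
    from that obtain f g where "\<forall>n. f n \<in> S" "f \<longlonglongrightarrow> x" "\<forall>n. g n \<in> S" "g \<longlonglongrightarrow> y"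
      unfolding closure_sequential by blast
    then show ?thesis
      unfolding closure_sequential
      by (intro exI[of _ "\<lambda>n. f n + g n"])
         (auto intro!: tendsto_add cvec.subspace_add[OF assms])
  qed
  show "c *\<^sub>C x \<in> closure S" if "x \<in> closure S" for c x
  proof -
    have "bounded_linear (\<lambda>x. c *\<^sub>C (x::'h))"
      by (rule bounded_linear_intro[of _ "cmod c"])
         (simp_all add: scaleC_add_right scaleR_scaleC scaleC_scaleC mult.commute norm_scaleC)
    then have "(\<lambda>x. c *\<^sub>C x) ` closure S \<subseteq> closure S"
      using assms by (intro image_closure_subset)
        (auto simp: linear_continuous_on cvec.subspace_scale intro: subsetD[OF closure_subset])
    with that show ?thesis by blast
  qed
qed

lemma subspace_closed_span: "cvec.subspace (closed_span A)"
  by (simp add: subspace_closure)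

lemma closed_span_base: "x \<in> A \<Longrightarrow> x \<in> closed_span A"
  using closure_subset cvec.span_base by blast

lemma closed_span_least: "A \<subseteq> closed_span B \<Longrightarrow> closed_span A \<subseteq> closed_span B"
  by (intro closure_minimal cvec.span_minimal subspace_closed_span) auto

lemma closed_span_eqI:
  "A \<subseteq> closed_span B \<Longrightarrow> B \<subseteq> closed_span A \<Longrightarrow> closed_span A = closed_span B"
  by (simp add: closed_span_least subset_antisym)

lemma orthogonal_closed_span:
  assumes "\<And>x. x \<in> A \<Longrightarrow> cinner x b = 0" and "x \<in> closed_span A"
  shows "cinner x b = 0"
proof -
  \<comment> \<open>The imaginary part of \<open>cinner x b\<close> is the real inner product of
    \<open>x\<close> with \<open>\<i> *\<^sub>C b\<close>, so closedness follows from continuity of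
    the real inner product.\<close>
  have eq: "{x. cinner x b = 0} = {x. inner x b = 0} \<inter> {x. inner x (\<i> *\<^sub>C b) = 0}"
    by (auto simp: inner_eq_Re_cinner cinner_scaleC_right complex_eq_iff)
  have "closed {x. cinner x b = 0}"
    unfolding eq by (intro closed_Int closed_Collect_eq continuous_intros)
  moreover have "cvec.subspace {x. cinner x b = 0}"
    by (rule cvec.subspaceI) (auto simp: cinner_sesquilinear)
  ultimately have "closed_span A \<subseteq> {x. cinner x b = 0}"
    using assms(1) by (intro closure_minimal cvec.span_minimal) auto
  with assms(2) show ?thesis by blast
qed

lemma orthogonal_closed_spans:
  assumes "\<And>x y. x \<in> A \<Longrightarrow> y \<in> B \<Longrightarrow> cinner x y = 0"
    and "x \<in> closed_span A" and "y \<in> closed_span B"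
  shows "cinner x y = 0"
proof -
  have "cinner z x = 0" if "z \<in> B" for z
    using orthogonal_closed_span[of A z x] assms that by (metis cinner_commute complex_cnj_zero)
  then have "cinner y x = 0"
    using orthogonal_closed_span[of B x y] assms(3) by blast
  then show ?thesis
    by (metis cinner_commute complex_cnj_zero)
qed

section \<open>Moves between diagonals of orthonormal families\<close>

definition orthonormal_on :: "'i set \<Rightarrow> ('i \<Rightarrow> 'h::complex_inner) \<Rightarrow> bool" where
  "orthonormal_on I e \<longleftrightarrow> (\<forall>i\<in>I. \<forall>j\<in>I. cinner (e i) (e j) = (if i = j then 1 else 0))"

definition diagonal_on :: "('h::complex_inner \<Rightarrow> 'h) \<Rightarrow> 'i set \<Rightarrow> ('i \<Rightarrow> 'h) \<Rightarrow> ('i \<Rightarrow> real) \<Rightarrow> bool" where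
  "diagonal_on E I e c \<longleftrightarrow>
     orthonormal_on I e \<and> (\<forall>i\<in>I. cinner (E (e i)) (e i) = complex_of_real (c i))"

text \<open>Quantifying over all families with entries \<open>a\<close> lets moves be composed.
  Keeping the closed span preserves completeness, and also orthogonality to whatever is orthogonal
  to the old family.\<close>

definition diagonal_move ::
  "('h::complex_inner \<Rightarrow> 'h) \<Rightarrow> 'i set \<Rightarrow> ('i \<Rightarrow> real) \<Rightarrow> 'j set \<Rightarrow> ('j \<Rightarrow> real) \<Rightarrow> bool" where
  "diagonal_move E I a J b \<longleftrightarrow>
     (\<forall>e. diagonal_on E I e a \<longrightarrow>
       (\<exists>g. diagonal_on E J g b \<and> closed_span (g ` J) = closed_span (e ` I)))"

lemma diagonal_move_trans:
  "diagonal_move E I a J b \<Longrightarrow> diagonal_move E J b K c \<Longrightarrow> diagonal_move E I a K c"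
  unfolding diagonal_move_def by metis

lemma diagonal_move_bij:
  assumes "bij_betw f J I" and "\<And>j. j \<in> J \<Longrightarrow> b j = a (f j)"
  shows "diagonal_move E I a J b"
  unfolding diagonal_move_def
proof (intro allI impI)
  fix e assume e: "diagonal_on E I e a"
  have "f j \<in> I" if "j \<in> J" for j
    using assms(1) that by (auto simp: bij_betw_def)
  moreover have "f i = f j \<longleftrightarrow> i = j" if "i \<in> J" "j \<in> J" for i j
    using assms(1) that by (auto simp: bij_betw_def inj_on_def)
  ultimately have "diagonal_on E J (e \<circ> f) b"
    using e assms(2) by (auto simp: diagonal_on_def orthonormal_on_def)
  moreover have "(e \<circ> f) ` J = e ` I"
    using assms(1) by (metis bij_betw_def image_comp)
  ultimately show "\<exists>g. diagonal_on E J g b \<and> closed_span (g ` J) = closed_span (e ` I)"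
    by metis
qed

text \<open>Each new block stays in the closed span of its old one, so different blocks remain
  orthogonal. Hence even infinitely many blocks can be moved at once without a limit
  process.\<close>

lemma diagonal_move_UNION:
  assumes move: "\<And>k. k \<in> K \<Longrightarrow> diagonal_move E (I k) a (J k) b"
    and disjI: "\<And>k m. k \<in> K \<Longrightarrow> m \<in> K \<Longrightarrow> k \<noteq> m \<Longrightarrow> I k \<inter> I m = {}"
    and disjJ: "\<And>k m. k \<in> K \<Longrightarrow> m \<in> K \<Longrightarrow> k \<noteq> m \<Longrightarrow> J k \<inter> J m = {}"
  shows "diagonal_move E (\<Union>k\<in>K. I k) a (\<Union>k\<in>K. J k) b"
  unfolding diagonal_move_def
proof (intro allI impI)
  fix e assume e: "diagonal_on E (\<Union>k\<in>K. I k) e a"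
  have "\<exists>g. diagonal_on E (J k) g b \<and> closed_span (g ` J k) = closed_span (e ` I k)" if "k \<in> K" for k
  proof -
    have "diagonal_on E (I k) e a"
      using e that by (auto simp: diagonal_on_def orthonormal_on_def)
    then show ?thesis
      using move[OF that] by (auto simp: diagonal_move_def)
  qed
  then obtain g where g: "\<And>k. k \<in> K \<Longrightarrow> diagonal_on E (J k) (g k) b"
    and span: "\<And>k. k \<in> K \<Longrightarrow> closed_span (g k ` J k) = closed_span (e ` I k)"
    by metis
  define G where "G = (\<lambda>j. g (SOME k. k \<in> K \<and> j \<in> J k) j)"
  have G: "G j = g k j" if "k \<in> K" "j \<in> J k" for k j
  proof -
    have "(SOME k. k \<in> K \<and> j \<in> J k) = k"
      using that disjJ by (intro some_equality) auto
    then show ?thesis by (simp add: G_def)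
  qed
  have mem: "G j \<in> closed_span (e ` I k)" if "k \<in> K" "j \<in> J k" for k j
    using that span closed_span_base[of "g k j" "g k ` J k"] by (auto simp: G)
  have "orthonormal_on (\<Union>k\<in>K. J k) G"
    unfolding orthonormal_on_def
  proof (intro ballI)
    fix i j assume "i \<in> (\<Union>k\<in>K. J k)" "j \<in> (\<Union>k\<in>K. J k)"
    then obtain k m where km: "k \<in> K" "i \<in> J k" "m \<in> K" "j \<in> J m" by blast
    show "cinner (G i) (G j) = (if i = j then 1 else 0)"
    proof (cases "k = m")
      case True
      then show ?thesis
        using km g[of k] by (auto simp: G diagonal_on_def orthonormal_on_def)
    next
      case False
      then have "i \<noteq> j" "\<And>x y. x \<in> I k \<Longrightarrow> y \<in> I m \<Longrightarrow> x \<noteq> y"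
        using disjI[of k m] disjJ[of k m] km by auto
      moreover from this have "cinner x y = 0" if "x \<in> e ` I k" "y \<in> e ` I m" for x y
        using e km that by (fastforce simp: diagonal_on_def orthonormal_on_def)
      ultimately show ?thesis
        using orthogonal_closed_spans[OF _ mem[of k i] mem[of m j]] km by auto
    qed
  qed
  moreover have "cinner (E (G j)) (G j) = complex_of_real (b j)" if "j \<in> (\<Union>k\<in>K. J k)" for j
    using that g by (auto simp: G diagonal_on_def)
  moreover have "closed_span (G ` (\<Union>k\<in>K. J k)) = closed_span (e ` (\<Union>k\<in>K. I k))"
  proof (rule closed_span_eqI)
    have "closed_span (e ` I k) \<subseteq> closed_span (e ` (\<Union>k\<in>K. I k))" if "k \<in> K" for k
      using that by (intro closed_span_least) (auto intro!: closed_span_base)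
    then show "G ` (\<Union>k\<in>K. J k) \<subseteq> closed_span (e ` (\<Union>k\<in>K. I k))"
      using mem by blast
    have "e i \<in> closed_span (G ` (\<Union>k\<in>K. J k))" if "k \<in> K" "i \<in> I k" for i k
    proof -
      have "e i \<in> closed_span (g k ` J k)"
        using that span closed_span_base[of "e i" "e ` I k"] by auto
      also have "\<dots> \<subseteq> closed_span (G ` (\<Union>k\<in>K. J k))"
        using that G by (intro closed_span_least) (force intro!: closed_span_base)
      finally show ?thesis .
    qed
    then show "e ` (\<Union>k\<in>K. I k) \<subseteq> closed_span (G ` (\<Union>k\<in>K. J k))"
      by blast
  qed
  ultimately show "\<exists>g. diagonal_on E (\<Union>k\<in>K. J k) g b \<and>
      closed_span (g ` (\<Union>k\<in>K. J k)) = closed_span (e ` (\<Union>k\<in>K. I k))"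
    unfolding diagonal_on_def by blast
qed

lemma diagonal_move_Un:
  assumes "diagonal_move E I a J b" "diagonal_move E I' a J' b" "I \<inter> I' = {}" "J \<inter> J' = {}"
  shows "diagonal_move E (I \<union> I') a (J \<union> J') b"
  using diagonal_move_UNION[of UNIV E "\<lambda>k. if k then I else I'" a "\<lambda>k. if k then J else J'" b] assms
  by (force simp: UNIV_bool Un_commute Int_commute)

lemma diagonal_on_uminus: "diagonal_on (\<lambda>x. - E x) I e (\<lambda>i. - c i) = diagonal_on E I e c"
  by (simp add: diagonal_on_def cinner_minus_left)

lemma diagonal_move_uminus:
  "diagonal_move (\<lambda>x. - E x) I (\<lambda>i. - a i) J (\<lambda>j. - b j) \<Longrightarrow> diagonal_move E I a J b"
  by (simp add: diagonal_move_def diagonal_on_uminus)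

lemma selfadjoint_uminus:
  fixes E :: "'h::complex_inner \<Rightarrow> 'h"
  assumes "selfadjoint_operator E"
  shows "selfadjoint_operator (\<lambda>x. - E x)"
  using assms
  by (auto simp: selfadjoint_operator_def bounded_operator_def cinner_minus_left cinner_minus_right
      bounded_linear_minus)

lemma is_diagonal_move:
  assumes "diagonal_move E UNIV a UNIV b" and "is_diagonal a E"
  shows "is_diagonal b E"
proof -
  obtain e where e: "orthonormal_basis e" "\<forall>i. cinner (E (e i)) (e i) = complex_of_real (a i)"
    using assms(2) by (auto simp: is_diagonal_def)
  then have "diagonal_on E UNIV e a"
    by (simp add: diagonal_on_def orthonormal_on_def orthonormal_basis_def)
  then obtain g where "diagonal_on E UNIV g b" "closed_span (range g) = closed_span (range e)"
    using assms(1) by (auto simp: diagonal_move_def)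
  then show ?thesis
    using e unfolding is_diagonal_def diagonal_on_def orthonormal_on_def orthonormal_basis_def
    by (intro exI[of _ g]) simp
qed

text \<open>The phase \<open>cross_phase E f e\<close> makes the real part of the cross term of \<open>E\<close> between \<open>f\<close> and
  \<open>e\<close> vanish, so that a rotation of the two vectors acts on diagonal entries as if \<open>E\<close> were
  diagonal.\<close>

definition cross_phase :: "('h::complex_inner \<Rightarrow> 'h) \<Rightarrow> 'h \<Rightarrow> 'h \<Rightarrow> complex" where
  "cross_phase E f e = (if cinner (E f) e = 0 then 1 else \<i> * sgn (cinner (E f) e))"

text \<open>Diagonal entries are quadratic in the vector, so the square roots become the convex
  weights \<open>p\<close> and \<open>1 - p\<close>.\<close>

definition rot1 :: "('h::complex_inner \<Rightarrow> 'h) \<Rightarrow> real \<Rightarrow> 'h \<Rightarrow> 'h \<Rightarrow> 'h" where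
  "rot1 E p f e = complex_of_real (sqrt p) *\<^sub>C f + (complex_of_real (sqrt (1 - p)) * cross_phase E f e) *\<^sub>C e"

definition rot2 :: "('h::complex_inner \<Rightarrow> 'h) \<Rightarrow> real \<Rightarrow> 'h \<Rightarrow> 'h \<Rightarrow> 'h" where
  "rot2 E p f e = complex_of_real (sqrt (1 - p)) *\<^sub>C f - (complex_of_real (sqrt p) * cross_phase E f e) *\<^sub>C e"

lemma cross_phase_unit: "cross_phase E f e * cnj (cross_phase E f e) = 1"
  by (simp add: cross_phase_def complex_norm_square[symmetric] norm_mult norm_sgn)

lemma cross_phase_cancel:
  "cnj (cross_phase E f e) * cinner (E f) e + cross_phase E f e * cnj (cinner (E f) e) = 0"
proof -
  \<comment> \<open>Both sides are the modulus of \<open>z\<close>. The phase multiplies one by \<i>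
    and the other by -\<i>, so their sum vanishes.\<close>
  have "sgn z * cnj z = cnj (sgn z) * z" for z
    by (simp add: sgn_eq)
  then show ?thesis
    by (simp add: cross_phase_def)
qed

locale rotation =
  fixes E :: "'h::complex_inner \<Rightarrow> 'h" and p x z :: real and f e :: 'h
  assumes sa: "selfadjoint_operator E"
    and f: "cinner f f = 1" and e: "cinner e e = 1" and fe: "cinner f e = 0"
    and Ef: "cinner (E f) f = complex_of_real x" and Ee: "cinner (E e) e = complex_of_real z"
    and p: "0 \<le> p" "p \<le> 1"
begin

lemma sqrt_square:
  "complex_of_real (sqrt p) * complex_of_real (sqrt p) = complex_of_real p"
  "complex_of_real (sqrt (1 - p)) * complex_of_real (sqrt (1 - p)) = 1 - complex_of_real p"
  using p by (simp_all flip: of_real_mult add: real_sqrt_mult_self)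

lemma ef: "cinner e f = 0"
  using fe by (metis cinner_commute complex_cnj_zero)

lemma E_lin: "E (u + v) = E u + E v" "E (c *\<^sub>C u) = c *\<^sub>C E u" "E (u - v) = E u - E v"
  using sa by (simp_all add: selfadjoint_operator_def bounded_operator_def
      linear_add linear_diff bounded_linear.linear)

lemma Eef: "cinner (E e) f = cnj (cinner (E f) e)"
  using sa by (metis cinner_commute selfadjoint_operator_def)

lemma comb_inner:
  "cinner (a *\<^sub>C f + (b * w) *\<^sub>C e) (a' *\<^sub>C f + (b' * w) *\<^sub>C e)
    = a * cnj a' + (b * cnj b') * (w * cnj w)"
  by (simp add: cinner_sesquilinear f e fe ef mult_ac)

lemma comb_value:
  "cinner (E (a *\<^sub>C f + (b * w) *\<^sub>C e)) (a *\<^sub>C f + (b * w) *\<^sub>C e)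
    = a * cnj a * x + (b * cnj b) * (w * cnj w) * z
      + (a * cnj b * (cnj w * cinner (E f) e) + b * cnj a * (w * cnj (cinner (E f) e)))"
  by (simp add: E_lin cinner_sesquilinear Ef Ee Eef distrib_left mult_ac)

lemma rot2_alt:
  "rot2 E p f e = complex_of_real (sqrt (1 - p)) *\<^sub>C f
     + (- complex_of_real (sqrt p) * cross_phase E f e) *\<^sub>C e"
  by (simp add: rot2_def)

lemma rot1_unit: "cinner (rot1 E p f e) (rot1 E p f e) = 1"
  unfolding rot1_def comb_inner cross_phase_unit by (simp add: sqrt_square)

lemma rot2_unit: "cinner (rot2 E p f e) (rot2 E p f e) = 1"
  unfolding rot2_alt comb_inner cross_phase_unit by (simp add: sqrt_square)

lemma rot_orthogonal: "cinner (rot2 E p f e) (rot1 E p f e) = 0"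
  unfolding rot1_def rot2_alt comb_inner cross_phase_unit by simp

lemma rot1_value: "cinner (E (rot1 E p f e)) (rot1 E p f e) = complex_of_real (p * x + (1 - p) * z)"
proof -
  have "cinner (E (rot1 E p f e)) (rot1 E p f e)
      = complex_of_real p * x + (1 - complex_of_real p) * z
        + complex_of_real (sqrt p) * complex_of_real (sqrt (1 - p)) *
          (cnj (cross_phase E f e) * cinner (E f) e + cross_phase E f e * cnj (cinner (E f) e))"
    unfolding rot1_def comb_value cross_phase_unit
    by (simp add: sqrt_square distrib_left mult_ac)
  then show ?thesis
    by (simp add: cross_phase_cancel)
qed

lemma rot2_value: "cinner (E (rot2 E p f e)) (rot2 E p f e) = complex_of_real ((1 - p) * x + p * z)"
proof -
  have "cinner (E (rot2 E p f e)) (rot2 E p f e)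
      = (1 - complex_of_real p) * x + complex_of_real p * z
        - complex_of_real (sqrt p) * complex_of_real (sqrt (1 - p)) *
          (cnj (cross_phase E f e) * cinner (E f) e + cross_phase E f e * cnj (cinner (E f) e))"
    unfolding rot2_alt comb_value cross_phase_unit
    by (simp add: sqrt_square distrib_left mult_ac)
  then show ?thesis
    by (simp add: cross_phase_cancel)
qed

lemma rot_inverse1:
  "f = complex_of_real (sqrt p) *\<^sub>C rot1 E p f e + complex_of_real (sqrt (1 - p)) *\<^sub>C rot2 E p f e"
proof -
  let ?s = "complex_of_real (sqrt p)" and ?c = "complex_of_real (sqrt (1 - p))"
  let ?w = "cross_phase E f e"
  have "?s *\<^sub>C rot1 E p f e + ?c *\<^sub>C rot2 E p f e
      = (?s * ?s + ?c * ?c) *\<^sub>C f + (?s * (?c * ?w) - ?c * (?s * ?w)) *\<^sub>C e"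
    unfolding rot1_def rot2_def
    by (simp add: scaleC_add_right scaleC_add_left cvec.scale_right_diff_distrib cvec.scale_left_diff_distrib scaleC_scaleC)
  also have "?s * (?c * ?w) - ?c * (?s * ?w) = 0" by simp
  finally show ?thesis by (simp add: sqrt_square)
qed

lemma rot_inverse2:
  "e = (complex_of_real (sqrt (1 - p)) * cnj (cross_phase E f e)) *\<^sub>C rot1 E p f e
       - (complex_of_real (sqrt p) * cnj (cross_phase E f e)) *\<^sub>C rot2 E p f e"
proof -
  let ?s = "complex_of_real (sqrt p)" and ?c = "complex_of_real (sqrt (1 - p))"
  let ?w = "cross_phase E f e"
  have "(?c * cnj ?w) *\<^sub>C rot1 E p f e - (?s * cnj ?w) *\<^sub>C rot2 E p f e
      = (?c * cnj ?w * ?s - ?s * cnj ?w * ?c) *\<^sub>C f + (?c * cnj ?w * (?c * ?w) + ?s * cnj ?w * (?s * ?w)) *\<^sub>C e"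
    unfolding rot1_def rot2_def
    by (simp add: scaleC_add_right scaleC_add_left cvec.scale_right_diff_distrib cvec.scale_left_diff_distrib scaleC_scaleC)
  also have "?c * cnj ?w * ?s - ?s * cnj ?w * ?c = 0" by simp
  also have "?c * cnj ?w * (?c * ?w) + ?s * cnj ?w * (?s * ?w) = 1"
  proof -
    have "?c * cnj ?w * (?c * ?w) + ?s * cnj ?w * (?s * ?w) = (?c * ?c + ?s * ?s) * (?w * cnj ?w)"
      by (simp add: algebra_simps)
    then show ?thesis by (simp add: sqrt_square cross_phase_unit)
  qed
  finally show ?thesis by simp
qed

end


lemma between_convex:
  fixes x z y :: real
  assumes "min x z \<le> y" "y \<le> max x z"
  obtains p where "0 \<le> p" "p \<le> 1" "y = p * x + (1 - p) * z"
proof (cases "x = z")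
  case True
  with assms show ?thesis by (intro that[of 1]) auto
next
  case False
  define p where "p = (y - z) / (x - z)"
  have "p * (x - z) = y - z"
    using False by (simp add: p_def)
  moreover have "0 \<le> p" "p \<le> 1"
    using assms False by (auto simp: p_def divide_simps min_def max_def split: if_splits)
  ultimately show ?thesis
    by (intro that[of p]) (auto simp: algebra_simps)
qed

text \<open>One parameter governs both rotated vectors: the position of \<open>b i\<close> between
  the old entries determines \<open>p\<close>, and the equal sums force \<open>b j\<close> to be the
  mirrored combination, which is the entry of \<open>rot2\<close>.\<close>

lemma diagonal_move_pair:
  fixes E :: "'h::complex_inner \<Rightarrow> 'h"
  assumes sa: "selfadjoint_operator E" and "i \<noteq> j"
    and sum: "a i + a j = b i + b j"
    and bi: "min (a i) (a j) \<le> b i" "b i \<le> max (a i) (a j)"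
  shows "diagonal_move E {i, j} a {i, j} b"
  unfolding diagonal_move_def
proof (intro allI impI)
  fix u assume u: "diagonal_on E {i, j} u a"
  obtain p where p: "0 \<le> p" "p \<le> 1" and bi_eq: "b i = p * a i + (1 - p) * a j"
    using between_convex[OF bi] .
  have bj_eq: "b j = (1 - p) * a i + p * a j"
    using sum bi_eq by (simp add: algebra_simps)
  interpret rotation E p "a i" "a j" "u i" "u j"
    using sa u p \<open>i \<noteq> j\<close> by unfold_locales (auto simp: diagonal_on_def orthonormal_on_def)
  define g where "g = (\<lambda>k. if k = i then rot1 E p (u i) (u j) else rot2 E p (u i) (u j))"
  have "cinner (rot1 E p (u i) (u j)) (rot2 E p (u i) (u j)) = 0"
    using rot_orthogonal by (metis cinner_commute complex_cnj_zero)
  then have "diagonal_on E {i, j} g b"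
    using \<open>i \<noteq> j\<close> rot1_unit rot2_unit rot_orthogonal rot1_value rot2_value
    by (auto simp: diagonal_on_def orthonormal_on_def g_def bi_eq bj_eq)
  moreover have "closed_span (g ` {i, j}) = closed_span (u ` {i, j})"
  proof (rule closed_span_eqI)
    show "g ` {i, j} \<subseteq> closed_span (u ` {i, j})"
      by (auto simp: g_def rot1_def rot2_def closed_span_base
          intro!: cvec.subspace_add cvec.subspace_diff cvec.subspace_scale subspace_closed_span)
    have "rot1 E p (u i) (u j) \<in> closed_span (g ` {i, j})" "rot2 E p (u i) (u j) \<in> closed_span (g ` {i, j})"
      using \<open>i \<noteq> j\<close> closed_span_base[of "g i" "g ` {i, j}"] closed_span_base[of "g j" "g ` {i, j}"]
      by (auto simp: g_def)
    then have "u i \<in> closed_span (g ` {i, j})" "u j \<in> closed_span (g ` {i, j})"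
      using rot_inverse1 rot_inverse2
      by (metis cvec.subspace_add cvec.subspace_scale subspace_closed_span,
          metis cvec.subspace_diff cvec.subspace_scale subspace_closed_span)
    then show "u ` {i, j} \<subseteq> closed_span (g ` {i, j})"
      by simp
  qed
  ultimately show "\<exists>g. diagonal_on E {i, j} g b \<and> closed_span (g ` {i, j}) = closed_span (u ` {i, j})"
    by blast
qed

text \<open>The involution encodes a pairing of the indices, with fixed points left alone. The pairs
  are disjoint, so all rotations happen simultaneously.\<close>

lemma diagonal_move_involution:
  fixes E :: "'h::complex_inner \<Rightarrow> 'h"
  assumes sa: "selfadjoint_operator E" and inv: "\<And>i. \<phi> (\<phi> i) = i"
    and sum: "\<And>i. a i + a (\<phi> i) = b i + b (\<phi> i)"
    and btw: "\<And>i. min (a i) (a (\<phi> i)) \<le> b i" "\<And>i. b i \<le> max (a i) (a (\<phi> i))"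
  shows "diagonal_move E UNIV a UNIV b"
proof -
  \<comment> \<open>The blocks serve as their own labels; labelling by \<open>i\<close> would list
    the block of \<open>i\<close> and \<open>\<phi> i\<close> twice and break disjointness.\<close>
  let ?K = "range (\<lambda>i. {i, \<phi> i})"
  have "diagonal_move E (\<Union>k\<in>?K. k) a (\<Union>k\<in>?K. k) b"
  proof (rule diagonal_move_UNION)
    fix k assume "k \<in> ?K"
    then obtain i where k: "k = {i, \<phi> i}" by blast
    show "diagonal_move E k a k b"
    proof (cases "\<phi> i = i")
      case True
      then have "b i = a i" using sum[of i] by simp
      then show ?thesis
        unfolding k True by (intro diagonal_move_bij[of id]) auto
    next
      case False
      then show ?thesis
        unfolding k using sum btw by (intro diagonal_move_pair[OF sa]) auto
    qed
  next
    show "k \<inter> m = {}" if "k \<in> ?K" "m \<in> ?K" "k \<noteq> m" for k m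
      using that inv by (auto; metis)
    then show "k \<inter> m = {}" if "k \<in> ?K" "m \<in> ?K" "k \<noteq> m" for k m
      using that by blast
  qed
  moreover have "(\<Union>k\<in>?K. k) = UNIV" by auto
  ultimately show ?thesis by simp
qed

text \<open>A carried vector is rotated successively with the members of the family, each rotation
  leaving one finished vector behind. The finished vectors span everything because the
  weight of the old carried vector in the new one is a product that tends to \<open>0\<close>.\<close>

lemma diagonal_move_chain:
  fixes E :: "'h::complex_inner \<Rightarrow> 'h" and v x p :: "nat \<Rightarrow> real"
  assumes sa: "selfadjoint_operator E"
    and p: "\<And>n. 0 \<le> p n" "\<And>n. p n \<le> 1"
    and x0: "x 0 = v 0" and xS: "\<And>n. x (Suc n) = (1 - p n) * x n + p n * v (Suc n)"
    and lim: "\<And>m. (\<lambda>n. \<Prod>k=m..<m+n. 1 - p k) \<longlonglongrightarrow> 0"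
  shows "diagonal_move E UNIV v UNIV (\<lambda>n. p n * x n + (1 - p n) * v (Suc n))"
  unfolding diagonal_move_def
proof (intro allI impI)
  fix u :: "nat \<Rightarrow> 'h" assume u: "diagonal_on E UNIV u v"
  then have uu: "cinner (u i) (u j) = (if i = j then 1 else 0)"
    and Eu: "cinner (E (u i)) (u i) = complex_of_real (v i)" for i j
    by (auto simp: diagonal_on_def orthonormal_on_def)
  \<comment> \<open>\<open>f n\<close> is the carried vector before step \<open>n\<close>:
    \<open>rot2\<close> is carried on, while \<open>rot1\<close> is left behind as the finished
    vector \<open>g n\<close>.\<close>
  define f where "f = rec_nat (u 0) (\<lambda>n fn. rot2 E (p n) fn (u (Suc n)))"
  have f0: "f 0 = u 0" and fS: "f (Suc n) = rot2 E (p n) (f n) (u (Suc n))" for n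
    by (simp_all add: f_def)
  define g where "g = (\<lambda>n. rot1 E (p n) (f n) (u (Suc n)))"
  have inv: "cinner (f n) (f n) = 1 \<and> cinner (E (f n)) (f n) = complex_of_real (x n) \<and>
      (\<forall>k>n. cinner (f n) (u k) = 0) \<and> f n \<in> cvec.span (range u)" for n
  proof (induction n)
    case 0
    then show ?case by (simp add: f0 uu Eu x0 cvec.span_base)
  next
    case (Suc n)
    interpret rotation E "p n" "x n" "v (Suc n)" "f n" "u (Suc n)"
      using Suc sa p by unfold_locales (auto simp: uu Eu)
    have "cinner (f (Suc n)) (u k) = 0" if "k > Suc n" for k
      using that Suc by (simp add: fS rot2_def cinner_sesquilinear uu)
    moreover have "f (Suc n) \<in> cvec.span (range u)"
      using Suc unfolding fS rot2_def
      by (intro cvec.span_diff cvec.span_scale) (auto simp: cvec.span_base)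
    ultimately show ?case
      using rot2_unit rot2_value by (simp add: fS xS)
  qed
  have rot: "rotation E (p n) (x n) (v (Suc n)) (f n) (u (Suc n))" for n
    using inv[of n] sa p by unfold_locales (auto simp: uu Eu)
  have gspan: "g n \<in> cvec.span (range u)" for n
    unfolding g_def rot1_def using inv[of n]
    by (intro cvec.span_add cvec.span_scale) (auto simp: cvec.span_base)
  have ug: "cinner (u k) (g n) = 0" if "k > Suc n" for k n
  proof -
    have "cinner (g n) (u k) = 0"
      using that inv[of n] by (simp add: g_def rot1_def cinner_sesquilinear uu)
    then show ?thesis by (metis cinner_commute complex_cnj_zero)
  qed
  have fg: "cinner (f m) (g n) = 0" if "m > n" for m n
    using that
  proof (induction m)
    case (Suc m)
    show ?case
    proof (cases "m = n")
      case True
      then show ?thesis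
        using rotation.rot_orthogonal[OF rot[of n]] by (simp add: fS g_def)
    next
      case False
      then show ?thesis
        using Suc ug by (simp add: fS rot2_def cinner_sesquilinear)
    qed
  qed simp
  have gg: "cinner (g m) (g n) = 0" if "m > n" for m n
  proof -
    have "g m = complex_of_real (sqrt (p m)) *\<^sub>C f m
        + (complex_of_real (sqrt (1 - p m)) * cross_phase E (f m) (u (Suc m))) *\<^sub>C u (Suc m)"
      by (simp add: g_def rot1_def)
    then show ?thesis
      using fg[OF that] ug[of n "Suc m"] that by (simp add: cinner_sesquilinear)
  qed
  have "cinner (g m) (g n) = (if m = n then 1 else 0)" for m n
    using gg[of m n] gg[of n m] rotation.rot1_unit[OF rot[of n]]
    by (metis cinner_commute complex_cnj_zero g_def linorder_neqE_nat)
  then have "diagonal_on E UNIV g (\<lambda>n. p n * x n + (1 - p n) * v (Suc n))"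
    using rotation.rot1_value[OF rot]
    by (auto simp: diagonal_on_def orthonormal_on_def g_def)
  moreover have "closed_span (range g) = closed_span (range u)"
  proof (rule closed_span_eqI)
    show "range g \<subseteq> closed_span (range u)"
      using gspan closure_subset by blast
    \<comment> \<open>Inverting the rotations one after another expresses \<open>f m\<close> by
      finished vectors and a remainder along the unit vector \<open>f (m + n)\<close>. The squared
      coefficient of the remainder is the product assumed to tend to 0.\<close>
    have tail: "\<exists>h \<in> cvec.span (range g).
        f m = h + complex_of_real (\<Prod>k=m..<m+n. sqrt (1 - p k)) *\<^sub>C f (m + n)" for m n
    proof (induction n)
      case 0
      then show ?case by (auto intro!: bexI[of _ 0] cvec.span_zero)
    next
      case (Suc n)
      then obtain h where h: "h \<in> cvec.span (range g)"
        and fm: "f m = h + complex_of_real (\<Prod>k=m..<m+n. sqrt (1 - p k)) *\<^sub>C f (m + n)" by blast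
      let ?c = "complex_of_real (\<Prod>k=m..<m+n. sqrt (1 - p k))"
      have "f (m + n) = complex_of_real (sqrt (p (m + n))) *\<^sub>C g (m + n)
          + complex_of_real (sqrt (1 - p (m + n))) *\<^sub>C f (m + Suc n)"
        using rotation.rot_inverse1[OF rot[of "m + n"]] by (simp add: g_def fS)
      then have "f m = (h + (?c * complex_of_real (sqrt (p (m + n)))) *\<^sub>C g (m + n))
          + (?c * complex_of_real (sqrt (1 - p (m + n)))) *\<^sub>C f (m + Suc n)"
        by (subst fm) (simp add: scaleC_add_right scaleC_scaleC add.assoc)
      moreover have "h + (?c * complex_of_real (sqrt (p (m + n)))) *\<^sub>C g (m + n) \<in> cvec.span (range g)"
        using h by (intro cvec.span_add cvec.span_scale) (auto simp: cvec.span_base)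
      ultimately show ?case
        by (intro bexI) (auto simp: prod.atLeastLessThan_Suc)
    qed
    have f_in: "f m \<in> closed_span (range g)" for m
      unfolding closure_approachable
    proof (intro allI impI)
      fix \<epsilon> :: real assume "\<epsilon> > 0"
      have "(\<lambda>n. sqrt (\<Prod>k=m..<m+n. 1 - p k)) \<longlonglongrightarrow> sqrt 0"
        by (intro tendsto_real_sqrt lim)
      then obtain n where n: "\<bar>sqrt (\<Prod>k=m..<m+n. 1 - p k)\<bar> < \<epsilon>"
        using \<open>\<epsilon> > 0\<close> by (auto simp: LIMSEQ_iff)
      have sqrt_prod: "sqrt (\<Prod>k\<in>A. 1 - p k) = (\<Prod>k\<in>A. sqrt (1 - p k))" for A
        by (induction A rule: infinite_finite_induct) (auto simp: real_sqrt_mult)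
      obtain h where h: "h \<in> cvec.span (range g)"
        and fm: "f m = h + complex_of_real (\<Prod>k=m..<m+n. sqrt (1 - p k)) *\<^sub>C f (m + n)"
        using tail by blast
      have "dist h (f m) < \<epsilon>"
        using n norm_unit[of "f (m + n)"] inv[of "m + n"]
        by (simp add: dist_norm fm norm_scaleC sqrt_prod del: of_real_prod)
      with h show "\<exists>y\<in>cvec.span (range g). dist y (f m) < \<epsilon>" by blast
    qed
    have "u m \<in> closed_span (range g)" for m
    proof (cases m)
      case 0
      then show ?thesis using f_in[of 0] by (simp add: f0)
    next
      case (Suc n)
      have "u (Suc n) = (complex_of_real (sqrt (1 - p n)) * cnj (cross_phase E (f n) (u (Suc n)))) *\<^sub>C g n
          - (complex_of_real (sqrt (p n)) * cnj (cross_phase E (f n) (u (Suc n)))) *\<^sub>C f (Suc n)"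
        unfolding g_def fS by (rule rotation.rot_inverse2[OF rot])
      then show ?thesis
        unfolding Suc
        using f_in[of "Suc n"] closed_span_base[of "g n" "range g"]
        by (metis cvec.subspace_diff cvec.subspace_scale subspace_closed_span rangeI)
    qed
    then show "range u \<subseteq> closed_span (range g)" by blast
  qed
  ultimately show "\<exists>g. diagonal_on E UNIV g (\<lambda>n. p n * x n + (1 - p n) * v (Suc n)) \<and>
      closed_span (range g) = closed_span (range u)"
    by blast
qed

section \<open>Rearranging and combining positive sequences\<close>

text \<open>Only finitely many values exceed a given positive one, so a largest remaining value
  always exists and can be picked. An element that is never picked would have infinitely many values
  at least as large as its own.\<close>

lemma sort_decreasing:
  fixes c :: "nat \<Rightarrow> real"
  assumes inf: "infinite I" and pos: "\<And>i. i \<in> I \<Longrightarrow> 0 < c i"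
    and fin: "\<And>\<alpha>. 0 < \<alpha> \<Longrightarrow> finite {i\<in>I. \<alpha> \<le> c i}"
  obtains \<sigma> where "bij_betw \<sigma> UNIV I" "decseq (\<lambda>n. c (\<sigma> n))"
proof -
  have ex: "\<exists>i. i \<in> I - C \<and> (\<forall>k\<in>I - C. c k \<le> c i)" if C: "finite C" for C
  proof -
    obtain i0 where i0: "i0 \<in> I - C"
      using inf C by (metis Diff_infinite_finite finite.emptyI ex_in_conv)
    let ?A = "{k\<in>I - C. c i0 \<le> c k}"
    have "finite ?A"
      using fin[of "c i0"] pos i0 by (auto elim: rev_finite_subset)
    moreover have "?A \<noteq> {}" using i0 by auto
    ultimately have "Max (c ` ?A) \<in> c ` ?A" by (intro Max_in) auto
    then obtain i where "i \<in> ?A" "c i = Max (c ` ?A)" by auto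
    moreover from this have "\<forall>k\<in>?A. c k \<le> c i"
      using \<open>finite ?A\<close> by simp
    ultimately have "i \<in> ?A" "\<forall>k\<in>?A. c k \<le> c i" by blast+
    then have "c k \<le> c i" if "k \<in> I - C" for k
      using that by (cases "c i0 \<le> c k") auto
    with \<open>i \<in> ?A\<close> show ?thesis by blast
  qed
  define pick where "pick C = (SOME i. i \<in> I - C \<and> (\<forall>k\<in>I - C. c k \<le> c i))" for C
  have pick: "pick C \<in> I - C" "k \<in> I - C \<Longrightarrow> c k \<le> c (pick C)" if "finite C" for C k
    using someI_ex[OF ex[OF that]] by (auto simp: pick_def)
  define C where "C = rec_nat {} (\<lambda>_ C. insert (pick C) C)"
  define \<sigma> where "\<sigma> n = pick (C n)" for n
  have C0: "C 0 = {}" and CS: "C (Suc n) = insert (\<sigma> n) (C n)" for n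
    by (simp_all add: C_def \<sigma>_def)
  have finC: "finite (C n)" for n
    by (induction n) (auto simp: C0 CS)
  have Cimg: "C n = \<sigma> ` {..<n}" for n
    by (induction n) (auto simp: C0 CS lessThan_Suc)
  note s = pick[OF finC, folded \<sigma>_def]
  have "decseq (\<lambda>n. c (\<sigma> n))"
  proof (intro decseq_SucI)
    show "c (\<sigma> (Suc n)) \<le> c (\<sigma> n)" for n
      using s(1)[of "Suc n"] s(2)[of "\<sigma> (Suc n)" n] by (simp add: CS)
  qed
  moreover have "bij_betw \<sigma> UNIV I"
    unfolding bij_betw_def
  proof
    have "\<sigma> m \<noteq> \<sigma> n" if "m < n" for m n
      using s(1)[of n] that unfolding Cimg by (metis DiffD2 imageI lessThan_iff)
    then show inj: "inj \<sigma>"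
      by (metis injI linorder_neqE_nat)
    have "i \<in> range \<sigma>" if "i \<in> I" for i
    proof (rule ccontr)
      assume i: "i \<notin> range \<sigma>"
      then have "i \<notin> C n" for n by (auto simp: Cimg)
      then have "c i \<le> c (\<sigma> n)" "\<sigma> n \<in> I" for n
        using s(1)[of n] s(2)[of i n] that by auto
      then have "range \<sigma> \<subseteq> {k\<in>I. c i \<le> c k}" by blast
      then show False
        using fin[of "c i"] pos[OF that] inj by (metis finite_subset range_inj_infinite)
    qed
    then show "range \<sigma> = I"
      using s(1) by blast
  qed
  ultimately show ?thesis by (rule that[rotated])
qed

text \<open>The queue \<open>\<rho> n\<close> enumerates the indices of \<open>l\<close> that are still unused at time \<open>n\<close>. As long
  as the queue leaves enough slack for it, a tiny element is drawn from far behind, otherwise the first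
  element is drawn. Divergence of the sum of \<open>d\<close> forces the second case infinitely often.\<close>

lemma reorder_slack:
  fixes l d :: "nat \<Rightarrow> real"
  assumes l: "\<And>n. 0 < l n" "l \<longlonglongrightarrow> 0"
    and d_unbounded: "\<And>C. \<exists>n. C < (\<Sum>i<n. d i)"
    and major: "\<And>n. (\<Sum>i<n. d i) \<le> (\<Sum>i<n. l i)"
  obtains \<pi> where "bij \<pi>" "\<And>n. (\<Sum>i<n. d i) \<le> (\<Sum>i<n. l (\<pi> i))"
    "\<And>N. \<exists>n\<ge>N. (\<Sum>i<n. l (\<pi> i)) < (\<Sum>i<n. d i) + d n"
proof -
  \<comment> \<open>With present surplus \<open>c\<close>, this is the surplus after
    \<open>k\<close> further steps if the queue were consumed in its present order.\<close>
  define gap where "gap n \<rho> c k = c + (\<Sum>j<k. l (\<rho> j)) - (\<Sum>j<k. d (n + j))"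
    for n k :: nat and \<rho> :: "nat \<Rightarrow> nat" and c :: real
  \<comment> \<open>Drawing from position \<open>N\<close> delays the elements in front of it by one
    step. The condition for all \<open>k\<close> keeps every future surplus nonnegative wherever the
    tiny element is found, as \<open>s_step\<close> shows; the bound \<open>(1/2)^n\<close> makes
    such draws summable.\<close>
  define pos where "pos n \<rho> c =
      (if \<forall>k. d (n + k) \<le> gap n \<rho> c k then SOME N. l (\<rho> N) \<le> (1/2)^n else 0)"
    for n :: nat and \<rho> :: "nat \<Rightarrow> nat" and c :: real
  define st where "st = rec_nat (id, 0) (\<lambda>n (\<rho>, c).
      (\<lambda>j. \<rho> (if j < pos n \<rho> c then j else Suc j), c + l (\<rho> (pos n \<rho> c)) - d n))"
  define \<rho> where "\<rho> n = fst (st n)" for n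
  define c where "c n = snd (st n)" for n
  define N where "N n = pos n (\<rho> n) (c n)" for n
  define \<pi> where "\<pi> n = \<rho> n (N n)" for n
  define s where "s n k = gap n (\<rho> n) (c n) k" for n k
  have \<rho>0: "\<rho> 0 = id" and c0: "c 0 = 0" by (simp_all add: \<rho>_def c_def st_def)
  have \<rho>S: "\<rho> (Suc n) = (\<lambda>j. \<rho> n (if j < N n then j else Suc j))" for n
    by (simp add: \<rho>_def c_def N_def st_def split_beta)
  have cS: "c (Suc n) = c n + l (\<pi> n) - d n" for n
    by (simp add: \<rho>_def c_def N_def st_def split_beta \<pi>_def)
  have s_eq: "s n k = c n + (\<Sum>j<k. l (\<rho> n j)) - (\<Sum>j<k. d (n + j))" for n k
    by (simp add: s_def gap_def)
  have c_eq: "c n = (\<Sum>i<n. l (\<pi> i)) - (\<Sum>i<n. d i)" for n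
    by (induction n) (auto simp: c0 cS)
  have N_eq: "N n = (if \<forall>k. d (n + k) \<le> s n k then SOME N. l (\<rho> n N) \<le> (1/2)^n else 0)" for n
    by (simp add: N_def pos_def s_def)
  have inj_\<rho>: "inj (\<rho> n)" for n
  proof (induction n)
    case (Suc n)
    have "inj (\<lambda>j. if j < N n then j else Suc j)"
      by (auto intro!: injI split: if_splits)
    with Suc show ?case
      unfolding \<rho>S by (rule inj_compose[unfolded comp_def])
  qed (simp add: \<rho>0)
  have tiny: "l (\<pi> n) \<le> (1/2)^n" if "\<forall>k. d (n + k) \<le> s n k" for n
  proof -
    have "\<forall>\<^sub>F i in sequentially. l i < (1/2)^n"
      using l(2) by (rule order_tendstoD) simp
    then have "finite {i. \<not> l i < (1/2)^n}"
      by (simp flip: cofinite_eq_sequentially add: eventually_cofinite)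
    then have "\<not> range (\<rho> n) \<subseteq> {i. \<not> l i < (1/2)^n}"
      using inj_\<rho> range_inj_infinite finite_subset by blast
    then have "\<exists>N. l (\<rho> n N) \<le> (1/2)^n"
      by (auto intro: less_imp_le)
    then have "l (\<rho> n (SOME N. l (\<rho> n N) \<le> (1/2)^n)) \<le> (1/2)^n"
      by (rule someI_ex)
    then show ?thesis
      using that by (simp add: \<pi>_def N_eq)
  qed
  have sum_\<rho>: "(\<Sum>j<k. l (\<rho> (Suc n) j)) =
      (if k \<le> N n then \<Sum>j<k. l (\<rho> n j) else (\<Sum>j<Suc k. l (\<rho> n j)) - l (\<pi> n))" for n k
    by (induction k) (auto simp: \<rho>S \<pi>_def le_less Suc_le_eq not_less not_le)
  have sum_d: "(\<Sum>j<k. d (Suc n + j)) + d n = (\<Sum>j<Suc k. d (n + j))" for n k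
    by (simp add: sum.lessThan_Suc_shift del: sum.lessThan_Suc)
  have s_step: "s (Suc n) k = (if k < N n then s n k + l (\<pi> n) - d (n + k) else s n (Suc k))" for n k
  proof (cases "k = N n")
    case True
    then show ?thesis
      using sum_d[where n=n and k=k] by (simp add: s_eq cS sum_\<rho> \<pi>_def del: add_Suc)
  next
    case False
    then show ?thesis
      using sum_d[where n=n and k=k] by (simp add: s_eq cS sum_\<rho> del: add_Suc)
  qed
  have s_nonneg: "0 \<le> s n k" for n k
  proof (induction n arbitrary: k)
    case 0
    then show ?case using major[of k] by (simp add: s_eq \<rho>0 c0)
  next
    case (Suc n)
    show ?case
    proof (cases "k < N n")
      case True
      then have "d (n + k) \<le> s n k" by (auto simp: N_eq split: if_splits)
      then show ?thesis using True l(1)[of "\<pi> n"] by (simp add: s_step)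
    qed (simp add: s_step Suc)
  qed
  have c_nonneg: "0 \<le> c n" for n
    using s_nonneg[of n 0] by (simp add: s_eq)
  have normal: "\<exists>n\<ge>n0. \<not> (\<forall>k. d (n + k) \<le> s n k)" for n0
  proof (rule ccontr)
    assume "\<not> ?thesis"
    then have tiny': "l (\<pi> n) \<le> (1/2)^n" if "n \<ge> n0" for n
      using tiny that by blast
    have "(\<Sum>i<n. l (\<pi> i)) \<le> (\<Sum>i<n0. l (\<pi> i)) + 2 - 2 * (1/2)^n" if "n \<ge> n0" for n
      using that
    proof (induction n rule: dec_induct)
      case base
      then show ?case by (simp add: power_le_one)
    next
      case (step n)
      then show ?case using tiny'[of n] by simp
    qed
    then have upper: "(\<Sum>i<n. d i) \<le> (\<Sum>i<n0. l (\<pi> i)) + 2" if "n \<ge> n0" for n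
      using c_nonneg[of n] that
      by (smt (verit) c_eq zero_le_power divide_nonneg_nonneg)
    obtain n where n: "\<bar>(\<Sum>i<n0. l (\<pi> i))\<bar> + 2 < (\<Sum>i<n. d i)"
      using d_unbounded by blast
    show False
    proof (cases "n \<ge> n0")
      case True
      then show ?thesis using upper[of n] n by linarith
    next
      case False
      have "(\<Sum>i<n. d i) \<le> (\<Sum>i<n. l (\<pi> i))" using c_nonneg[of n] by (simp add: c_eq)
      also have "\<dots> \<le> (\<Sum>i<n0. l (\<pi> i))"
        using False l(1) by (intro sum_mono2) (auto intro: less_imp_le)
      finally show ?thesis using n by linarith
    qed
  qed
  have "\<exists>n\<ge>n0. c n < d n" for n0
  proof -
    \<comment> \<open>A failure of the slack condition at distance \<open>k\<close> forces an
      ordinary draw, which moves the failure one step closer. At distance 0 it says that the surplus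
      is below the next entry of \<open>d\<close>.\<close>
    have "c (n + k) < d (n + k)" if "s n k < d (n + k)" for n k
      using that
    proof (induction k arbitrary: n)
      case 0
      then show ?case by (simp add: s_eq)
    next
      case (Suc k)
      then have "N n = 0" by (metis N_eq not_less)
      then show ?case using Suc.prems Suc.IH[of "Suc n"] by (simp add: s_step)
    qed
    then show ?thesis
      using normal[of n0] by (meson le_add1 le_trans not_le)
  qed
  then have often: "\<exists>n\<ge>N. (\<Sum>i<n. l (\<pi> i)) < (\<Sum>i<n. d i) + d n" for N
    by (simp add: c_eq less_diff_eq algebra_simps)
  have range_S: "range (\<rho> (Suc n)) \<subseteq> range (\<rho> n) - {\<pi> n}" for n
    by (auto simp: \<rho>S \<pi>_def dest!: injD[OF inj_\<rho>] split: if_splits)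
  have range_mono: "range (\<rho> n) \<subseteq> range (\<rho> m)" if "m \<le> n" for m n
    using that
  proof (induction n rule: dec_induct)
    case (step n)
    then show ?case using range_S[of n] by blast
  qed simp
  have "\<pi> m \<noteq> \<pi> n" if "m < n" for m n
  proof -
    have "\<pi> n \<in> range (\<rho> n)"
      unfolding \<pi>_def by (rule rangeI)
    then have "\<pi> n \<in> range (\<rho> (Suc m))"
      using range_mono[of "Suc m" n] that by auto
    then show ?thesis
      using range_S[of m] by auto
  qed
  then have inj: "inj \<pi>"
    by (metis injI linorder_neqE_nat)
  \<comment> \<open>Waiting elements never move back in the queue and advance at every ordinary
    draw, so induction on the position shows that each is drawn.\<close>
  have drawn: "\<exists>m\<ge>n. \<pi> m = \<rho> n j" for n j
  proof (induction j arbitrary: n rule: less_induct)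
    case (less j)
    have moved: "(\<exists>m\<ge>n. \<pi> m = \<rho> n j) \<or> (\<exists>i\<le>j. \<rho> (n + t) i = \<rho> n j)" for t
    proof (induction t)
      case (Suc t)
      then consider "\<exists>m\<ge>n. \<pi> m = \<rho> n j" | i where "i \<le> j" "\<rho> (n + t) i = \<rho> n j" by blast
      then show ?case
      proof cases
        case 2
        consider "N (n + t) = i" | "i < N (n + t)" | i' where "i = Suc i'" "N (n + t) \<le> i'"
          by (metis less_Suc_eq_le linorder_neqE_nat not0_implies_Suc not_less_zero)
        then show ?thesis
        proof cases
          case 1
          then have "\<pi> (n + t) = \<rho> n j" using 2 by (simp add: \<pi>_def)
          then show ?thesis using le_add1 by blast
        next
          case 22: 2
          then have "\<rho> (n + Suc t) i = \<rho> n j" using 2 by (simp add: \<rho>S)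
          then show ?thesis using 2 by blast
        next
          case 3
          then have "\<rho> (n + Suc t) i' = \<rho> n j" using 2 by (simp add: \<rho>S)
          then show ?thesis using 2 3 by (meson Suc_leD)
        qed
      qed blast
    qed auto
    obtain t where t: "\<not> (\<forall>k. d (n + t + k) \<le> s (n + t) k)"
      using normal[of n] by (metis le_iff_add)
    then have N0: "N (n + t) = 0" unfolding N_eq by presburger
    show ?case
      using moved[of t]
    proof
      assume "\<exists>i\<le>j. \<rho> (n + t) i = \<rho> n j"
      then obtain i where i: "i \<le> j" "\<rho> (n + t) i = \<rho> n j" by blast
      show ?thesis
      proof (cases i)
        case 0
        then have "\<pi> (n + t) = \<rho> n j" using i N0 by (simp add: \<pi>_def)
        then show ?thesis using le_add1 by blast
      next
        case (Suc i')
        then have "\<rho> (Suc (n + t)) i' = \<rho> n j" using i N0 by (simp add: \<rho>S)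
        moreover obtain m where "m \<ge> Suc (n + t)" "\<pi> m = \<rho> (Suc (n + t)) i'"
          using less[of i'] Suc i(1) by (metis Suc_le_lessD)
        ultimately show ?thesis
          by (metis Suc_leD add_leD1)
      qed
    qed blast
  qed
  have "surj \<pi>"
    using drawn[of 0] by (metis \<rho>0 id_apply surjI surj_def)
  with inj have "bij \<pi>" by (simp add: bij_def)
  then show ?thesis
    using c_nonneg often by (intro that[of \<pi>]) (simp_all add: c_eq)
qed

text \<open>At time \<open>n\<close> the carried value is \<open>x n\<close>, the indices in \<open>C n\<close> have been used, and the unused
  indices below \<open>M n\<close> have values at least \<open>d n\<close> and were skipped. If \<open>x n \<ge> d n\<close>,
  the carried vector is combined with the next value that is at most \<open>d n\<close>; otherwise with the oldest
  skipped value.\<close>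

lemma chain_parameters:
  fixes l d :: "nat \<Rightarrow> real"
  assumes l: "\<And>n. 0 < l n" "l \<longlonglongrightarrow> 0"
    and d: "\<And>n. 0 < d n" "decseq d" "d \<longlonglongrightarrow> 0"
    and major: "\<And>n. (\<Sum>i<n. d i) \<le> (\<Sum>i<n. l i)"
    and tight: "\<And>N. \<exists>n\<ge>N. (\<Sum>i<n. l i) < (\<Sum>i<n. d i) + d n"
  obtains \<sigma> p x where "bij \<sigma>" "\<And>n. 0 \<le> p n" "\<And>n. p n \<le> 1"
    "x 0 = l (\<sigma> 0)" "\<And>n. x (Suc n) = (1 - p n) * x n + p n * l (\<sigma> (Suc n))"
    "\<And>n. d n = p n * x n + (1 - p n) * l (\<sigma> (Suc n))"
    "\<And>m. (\<lambda>n. \<Prod>k=m..<m+n. 1 - p k) \<longlonglongrightarrow> 0"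
proof -
  define pick where "pick n x C M = (if d n \<le> x then LEAST i. M \<le> i \<and> l i \<le> d n else LEAST i. i \<notin> C)"
    for n M :: nat and x :: real and C :: "nat set"
  define st where "st = rec_nat (l 0, {0}, 1) (\<lambda>n (x, C, M).
      (x + l (pick n x C M) - d n, insert (pick n x C M) C,
       if d n \<le> x then Suc (pick n x C M) else M))"
  define x where "x n = fst (st n)" for n
  define C where "C n = fst (snd (st n))" for n
  define M where "M n = snd (snd (st n))" for n
  define j where "j n = pick n (x n) (C n) (M n)" for n
  define D where "D n = (\<Sum>i<n. l i) - (\<Sum>i<n. d i)" for n
  have init: "x 0 = l 0" "C 0 = {0}" "M 0 = 1"
    by (simp_all add: x_def C_def M_def st_def)
  have xS: "x (Suc n) = x n + l (j n) - d n" and CS: "C (Suc n) = insert (j n) (C n)"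
    and MS: "M (Suc n) = (if d n \<le> x n then Suc (j n) else M n)" for n
    by (simp_all add: x_def C_def M_def j_def st_def split_beta)
  have dec: "d n \<le> d m" if "m \<le> n" for m n
    using d(2) that by (simp add: decseq_def)
  have fresh: "M n \<le> j n \<and> l (j n) \<le> d n \<and> (\<forall>i. M n \<le> i \<and> i < j n \<longrightarrow> d n < l i)" if "d n \<le> x n" for n
  proof -
    have "\<forall>\<^sub>F i in sequentially. l i < d n"
      using l(2) d(1) by (rule order_tendstoD)
    then obtain i where "M n \<le> i" "l i \<le> d n"
      by (metis eventually_sequentially less_imp_le nat_le_linear)
    then have "M n \<le> (LEAST i. M n \<le> i \<and> l i \<le> d n) \<and> l (LEAST i. M n \<le> i \<and> l i \<le> d n) \<le> d n"
      by (intro LeastI[of "\<lambda>i. M n \<le> i \<and> l i \<le> d n" i]) simp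
    moreover have "d n < l i" if "M n \<le> i" "i < (LEAST i. M n \<le> i \<and> l i \<le> d n)" for i
      using not_less_Least[OF that(2)] that(1) by auto
    ultimately show ?thesis
      using that by (simp add: j_def pick_def)
  qed
  have inv: "0 < x n \<and> finite (C n) \<and> card (C n) = Suc n \<and> C n \<subseteq> {..<M n} \<and>
      x n = (\<Sum>i\<in>C n. l i) - (\<Sum>i<n. d i) \<and> (\<forall>i<M n. i \<notin> C n \<longrightarrow> d n \<le> l i) \<and>
      (x n < d n \<longrightarrow> (\<exists>i<M n. i \<notin> C n))" for n
  proof (induction n)
    case 0
    have "d 0 \<le> l 0" using major[of 1] by simp
    then show ?case using l by (simp add: init)
  next
    case (Suc n)
    have jC: "j n \<notin> C n \<and> C (Suc n) \<subseteq> {..<M (Suc n)} \<and>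
        (\<forall>i<M (Suc n). i \<notin> C (Suc n) \<longrightarrow> d n \<le> l i) \<and> (0 < x (Suc n))"
    proof (cases "d n \<le> x n")
      case True
      then show ?thesis
        using fresh[OF True] Suc l(1)[of "j n"]
        by (auto simp: CS MS xS less_Suc_eq subset_iff) (meson less_imp_le not_le)+
    next
      case False
      then have j: "j n = (LEAST i. i \<notin> C n)" by (simp add: j_def pick_def)
      obtain i where i: "i < M n" "i \<notin> C n" using Suc False by auto
      then have "j n \<notin> C n" "j n < M n"
        unfolding j by (metis LeastI) (metis Least_le i le_less_trans)
      then show ?thesis using Suc False by (auto simp: CS MS xS add_strict_increasing)
    qed
    \<comment> \<open>If nothing has been skipped, the used indices form an initial segment, and
      majorization alone makes the carried value at least the next entry of \<open>d\<close>. Thus a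
      carried value that is too small always finds a skipped partner.\<close>
    have "\<exists>i<M (Suc n). i \<notin> C (Suc n)" if "x (Suc n) < d (Suc n)"
    proof (rule ccontr)
      assume "\<not> ?thesis"
      then have eq: "C (Suc n) = {..<M (Suc n)}" using jC by auto
      then have "M (Suc n) = Suc (Suc n)"
        using Suc jC by (metis CS card_insert_disjoint card_lessThan)
      then have "(\<Sum>i\<in>C (Suc n). l i) = (\<Sum>i<Suc (Suc n). l i)"
        by (simp only: eq)
      moreover have "x (Suc n) = (\<Sum>i\<in>C (Suc n). l i) - (\<Sum>i<Suc n. d i)"
        using Suc jC by (simp add: xS CS)
      ultimately have "x (Suc n) = D (Suc (Suc n)) + d (Suc n)"
        by (simp add: D_def)
      then show False using that major[of "Suc (Suc n)"] by (simp add: D_def)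
    qed
    moreover have "d (Suc n) \<le> d n" by (simp add: dec)
    ultimately show ?case
      using Suc jC by (auto simp: CS xS intro: order_trans)
  qed
  then have x_pos: "0 < x n" and finC: "finite (C n)" and cardC: "card (C n) = Suc n"
    and C_sub: "C n \<subseteq> {..<M n}" and x_eq: "x n = (\<Sum>i\<in>C n. l i) - (\<Sum>i<n. d i)"
    and skipped: "i < M n \<Longrightarrow> i \<notin> C n \<Longrightarrow> d n \<le> l i"
    and nonempty: "x n < d n \<Longrightarrow> \<exists>i<M n. i \<notin> C n" for n i
    by blast+
  have least: "j n = (LEAST i. i \<notin> C n)" if "x n < d n" for n
    using that by (simp add: j_def pick_def)
  have j_new: "j n \<notin> C n" for n
  proof (cases "d n \<le> x n")
    case True
    then show ?thesis using fresh C_sub by (metis lessThan_iff not_less subsetD)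
  next
    case False
    then show ?thesis using nonempty[of n] least[of n] by (metis LeastI not_le)
  qed
  have M_gt: "n < M n" for n
    using card_mono[OF finite_lessThan C_sub[of n]] by (simp add: cardC)
  have M_mono: "M m \<le> M n" if "m \<le> n" for m n
  proof (rule lift_Suc_mono_le[OF _ that])
    show "M n \<le> M (Suc n)" for n
      using fresh[of n] by (auto simp: MS)
  qed
  have C_eq: "C n = insert 0 (j ` {..<n})" for n
    by (induction n) (auto simp: init CS lessThan_Suc)

  \<comment> \<open>Skipping only increases \<open>D\<close>, so the excess at \<open>M n\<close> bounds it from below up to \<open>M (Suc n)\<close>.\<close>
  have D_lower: "x n - d n + (\<Sum>i\<in>{..<M n} - C n. l i - d n) \<le> D m"
    if "M n \<le> m" "m < M (Suc n)" for n m
    using that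
  proof (induction m rule: dec_induct)
    case base
    have "(\<Sum>i=n..<M n. d i) \<le> (\<Sum>i=n..<M n. d n)"
      by (intro sum_mono dec) simp
    moreover have "{..<n} \<union> {n..<M n} = {..<M n}"
      using M_gt[of n] by auto
    then have "(\<Sum>i<M n. d i) = (\<Sum>i<n. d i) + (\<Sum>i=n..<M n. d i)"
      by (metis finite_atLeastLessThan finite_lessThan ivl_disj_int_one(2) sum.union_disjoint)
    moreover have "(\<Sum>i<M n. l i) = (\<Sum>i\<in>C n. l i) + (\<Sum>i\<in>{..<M n} - C n. l i)"
      by (metis C_sub add.commute finite_lessThan sum.subset_diff)
    moreover have "real (card ({..<M n} - C n)) = real (M n) - real n - 1"
      using M_gt[of n] by (simp add: card_Diff_subset finC C_sub cardC of_nat_diff)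
    then have "real (card ({..<M n} - C n)) * d n = real (M n) * d n - real n * d n - d n"
      by (simp only: left_diff_distrib mult_1_left)
    ultimately show ?case
      using M_gt[of n] by (simp add: D_def x_eq sum_subtractf of_nat_diff algebra_simps)
  next
    case (step i)
    have le: "d n \<le> x n" using step by (auto simp: MS split: if_splits)
    then have "i < j n" using step by (simp add: MS)
    then have "d n < l i" using fresh[OF le] step by auto
    moreover have "d i \<le> d n" using dec M_gt[of n] step by simp
    ultimately show ?case using step by (simp add: D_def)
  qed
  have interval: "\<exists>n\<ge>N. M n \<le> m \<and> m < M (Suc n)" if "M N \<le> m" for N m
  proof -
    define k where "k = (LEAST k. m < M k)"
    have k: "m < M k" unfolding k_def using M_gt by (rule LeastI)
    have "N < k" using k M_mono that by (metis le_less_trans not_le not_less)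
    then obtain n where n: "k = Suc n" "N \<le> n" by (metis Suc_less_eq2 less_Suc_eq_le lessE less_imp_Suc_add)
    then have "\<not> m < M n" using not_less_Least[of n "\<lambda>k. m < M k"] by (simp add: k_def)
    with n k show ?thesis by auto
  qed
  \<comment> \<open>At a late tight \<open>m\<close> the excess \<open>D m\<close> is below
    \<open>d m\<close>. By \<open>D_lower\<close> this also bounds the carried and skipped surplus
    at the time \<open>n\<close> whose interval contains \<open>m\<close>.\<close>
  have small: "\<exists>n\<ge>N. x n - d n + (\<Sum>i\<in>{..<M n} - C n. l i - d n) < \<epsilon> \<and> d n < \<epsilon>"
    if "0 < \<epsilon>" for N and \<epsilon> :: real
  proof -
    have "\<forall>\<^sub>F n in sequentially. d n < \<epsilon>"
      using d(3) that by (rule order_tendstoD)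
    then obtain N' where N': "\<And>n. n \<ge> N' \<Longrightarrow> d n < \<epsilon>"
      by (auto simp: eventually_sequentially)
    obtain m where m: "m \<ge> max (M (max N N')) N'" "(\<Sum>i<m. l i) < (\<Sum>i<m. d i) + d m"
      using tight by blast
    then obtain n where n: "n \<ge> max N N'" "M n \<le> m" "m < M (Suc n)"
      using interval by (meson max.boundedE)
    have "D m < \<epsilon>" using m N'[of m] by (simp add: D_def)
    then show ?thesis
      using D_lower[OF n(2,3)] n N' by (intro exI[of _ n]) auto
  qed
  have sum_nonneg: "0 \<le> (\<Sum>i\<in>{..<M n} - C n. l i - d n)" for n
    using skipped by (intro sum_nonneg) auto
  have x_small: "\<exists>n\<ge>N. x n < \<epsilon>" if \<epsilon>: "0 < \<epsilon>" for N \<epsilon>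
  proof -
    obtain n where "n \<ge> N" "x n - d n + (\<Sum>i\<in>{..<M n} - C n. l i - d n) < \<epsilon> / 2" "d n < \<epsilon> / 2"
      using small[OF half_gt_zero[OF \<epsilon>], of N] by blast
    with sum_nonneg[of n] show ?thesis by (intro exI[of _ n]) auto
  qed
  have inj_j: "inj j"
  proof -
    have "j m \<noteq> j n" if "m < n" for m n
      using j_new[of n] that unfolding C_eq by (metis imageI insertI2 lessThan_iff)
    then show ?thesis by (metis injI linorder_neqE_nat)
  qed
  have used: "\<exists>n. s \<in> C n" for s
  proof (rule ccontr)
    assume "\<not> ?thesis"
    then have s: "s \<notin> C n" for n by blast
    have "\<exists>n\<ge>N. x n < d n" for N
    proof -
      obtain n where n: "n \<ge> max N s" "x n - d n + (\<Sum>i\<in>{..<M n} - C n. l i - d n) < l s / 2" "d n < l s / 2"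
        using small[of "l s / 2" "max N s"] l(1)[of s] by auto
      have "l s - d n \<le> (\<Sum>i\<in>{..<M n} - C n. l i - d n)"
        using s M_gt[of n] n(1) skipped by (intro member_le_sum) auto
      with n show ?thesis by (intro exI[of _ n]) auto
    qed
    then have "infinite {n. x n < d n}"
      by (simp add: infinite_nat_iff_unbounded_le)
    moreover have "j ` {n. x n < d n} \<subseteq> {..s}"
      using s by (auto simp: least intro: Least_le)
    ultimately show False
      using inj_j by (meson finite_atMost finite_imageD finite_subset inj_on_subset subset_UNIV)
  qed
  have "\<exists>p. 0 \<le> p \<and> p \<le> 1 \<and> d n = p * x n + (1 - p) * l (j n)" for n
  proof -
    have "min (x n) (l (j n)) \<le> d n \<and> d n \<le> max (x n) (l (j n))"
    proof (cases "d n \<le> x n")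
      case True
      then show ?thesis using fresh[OF True] by auto
    next
      case False
      then obtain i where "i < M n" "i \<notin> C n" using nonempty[of n] by auto
      then have "j n < M n" using False by (auto simp: least intro: Least_le le_less_trans)
      then show ?thesis using False skipped[OF \<open>j n < M n\<close> j_new] by auto
    qed
    then show ?thesis by (metis between_convex)
  qed
  then obtain p where p: "\<And>n. 0 \<le> p n" "\<And>n. p n \<le> 1"
    and d_eq: "\<And>n. d n = p n * x n + (1 - p n) * l (j n)"
    by metis
  have x_step: "x (Suc n) = (1 - p n) * x n + p n * l (j n)" for n
    using xS[of n] d_eq[of n] by (simp add: algebra_simps)
  \<comment> \<open>All contributions to the carried value are nonnegative, so the weight of
    \<open>x m\<close> that survives in \<open>x (m + n)\<close> is at most their quotient. This
    turns small carried values into the vanishing product that completeness requires.\<close>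
  have prod_le: "(\<Prod>k=m..<m+n. 1 - p k) * x m \<le> x (m + n)" for m n
  proof (induction n)
    case (Suc n)
    have "(\<Prod>k=m..<m + Suc n. 1 - p k) * x m = (1 - p (m + n)) * ((\<Prod>k=m..<m+n. 1 - p k) * x m)"
      by (simp add: mult_ac)
    also have "\<dots> \<le> (1 - p (m + n)) * x (m + n)"
      using Suc p by (intro mult_left_mono) auto
    also have "\<dots> \<le> x (m + Suc n)"
      using p l(1) by (simp add: x_step less_imp_le)
    finally show ?case .
  qed simp
  have prod_lim: "(\<lambda>n. \<Prod>k=m..<m+n. 1 - p k) \<longlonglongrightarrow> 0" for m
  proof (rule LIMSEQ_I)
    let ?q = "\<lambda>n. \<Prod>k=m..<m+n. 1 - p k"
    fix \<epsilon> :: real assume "0 < \<epsilon>"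
    then obtain n0 where n0: "n0 \<ge> m" "x n0 < \<epsilon> * x m"
      using x_small[of "\<epsilon> * x m" m] x_pos[of m] by auto
    have q0: "0 \<le> ?q n" for n
      using p by (intro prod_nonneg) auto
    have "decseq ?q"
      using q0 p by (intro decseq_SucI) (simp add: mult_left_le)
    have "?q (n0 - m) * x m < \<epsilon> * x m"
      using prod_le[of m "n0 - m"] n0 by simp
    then have "?q (n0 - m) < \<epsilon>"
      using x_pos[of m] by simp
    then have "?q n < \<epsilon>" if "n \<ge> n0 - m" for n
      using decseqD[OF \<open>decseq ?q\<close> that] by linarith
    then show "\<exists>no. \<forall>n\<ge>no. norm (?q n - 0) < \<epsilon>"
      using q0 by auto
  qed
  define \<sigma> where "\<sigma> n = (case n of 0 \<Rightarrow> 0 | Suc k \<Rightarrow> j k)" for n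
  have \<sigma>: "\<sigma> 0 = 0" "\<sigma> (Suc k) = j k" for k
    by (simp_all add: \<sigma>_def)
  have j0: "j n \<noteq> 0" for n
    using j_new[of n] by (simp add: C_eq)
  have "m = n" if "\<sigma> m = \<sigma> n" for m n
    using that j0 j0[symmetric] injD[OF inj_j] by (cases m; cases n) (simp_all add: \<sigma>)
  then have "inj \<sigma>" by (rule injI)
  moreover have "s \<in> range \<sigma>" for s
  proof -
    obtain n where "s = 0 \<or> s \<in> j ` {..<n}" using used[of s] by (auto simp: C_eq)
    then show ?thesis
      by (metis \<sigma> imageE rangeI)
  qed
  then have "surj \<sigma>" by blast
  ultimately have "bij \<sigma>" by (simp add: bij_def)
  then show ?thesis
    using p prod_lim x_step d_eq init by (intro that[of \<sigma> p x]) (simp_all add: \<sigma>_def)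
qed

section \<open>Excess over a threshold\<close>

text \<open>The sum of the positive parts of \<open>c i - \<alpha>\<close>. Applied to the negated
  sequence it yields the sums of \<open>delta\<close> at negative arguments.\<close>

definition excess :: "(nat \<Rightarrow> real) \<Rightarrow> real \<Rightarrow> real" where
  "excess c \<alpha> = (\<Sum>i | \<alpha> \<le> c i. c i - \<alpha>)"

text \<open>For null sequences this is divergence of the sum of the positive entries, expressed by
  finite real sums.\<close>

definition excess_unbounded :: "(nat \<Rightarrow> real) \<Rightarrow> bool" where
  "excess_unbounded c \<longleftrightarrow> (\<forall>C. \<exists>\<alpha>>0. C < excess c \<alpha>)"

lemma null_sequence_iff:
  fixes c :: "nat \<Rightarrow> real"
  shows "c \<longlonglongrightarrow> 0 \<longleftrightarrow> (\<forall>\<epsilon>>0. finite {i. \<epsilon> \<le> \<bar>c i\<bar>})"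
  by (simp add: tendsto_iff flip: cofinite_eq_sequentially)
     (simp add: eventually_cofinite not_less)

lemma finite_level:
  fixes c :: "nat \<Rightarrow> real"
  assumes "c \<longlonglongrightarrow> 0" "0 < \<alpha>"
  shows "finite {i. \<alpha> \<le> c i}"
  using assms by (auto simp: null_sequence_iff elim!: allE[of _ \<alpha>] rev_finite_subset)

text \<open>Terms below \<open>\<alpha>\<close> contribute negatively, so the level set is the best
  choice of a finite set and every other choice gives a lower bound.\<close>

lemma excess_ge:
  assumes c: "c \<longlonglongrightarrow> 0" "0 < \<alpha>" and "finite F"
  shows "(\<Sum>i\<in>F. c i - \<alpha>) \<le> excess c \<alpha>"
proof -
  have "(\<Sum>i\<in>F. c i - \<alpha>) \<le> (\<Sum>i\<in>F \<inter> {i. \<alpha> \<le> c i}. c i - \<alpha>)"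
    using \<open>finite F\<close> by (subst sum.inter_restrict) (auto intro!: sum_mono)
  also have "\<dots> \<le> excess c \<alpha>"
    unfolding excess_def by (intro sum_mono2 finite_level c) auto
  finally show ?thesis .
qed

lemma excess_antimono:
  assumes c: "c \<longlonglongrightarrow> 0" and "0 < \<alpha>" "\<alpha> \<le> \<beta>"
  shows "excess c \<beta> \<le> excess c \<alpha>"
proof -
  have "excess c \<beta> \<le> (\<Sum>i | \<beta> \<le> c i. c i - \<alpha>)"
    unfolding excess_def using assms by (intro sum_mono) auto
  also have "\<dots> \<le> excess c \<alpha>"
    using assms by (intro excess_ge finite_level) auto
  finally show ?thesis .
qed

text \<open>The level set of \<open>c'\<close> is one of the competitors in the maximum that defines
  \<open>excess c \<alpha>\<close>.\<close>

lemma excess_change: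
  assumes "c \<longlonglongrightarrow> 0" "c' \<longlonglongrightarrow> 0" "0 < \<alpha>"
  shows "excess c' \<alpha> \<le> excess c \<alpha> + (\<Sum>i | \<alpha> \<le> c' i. c' i - c i)"
proof -
  have "excess c' \<alpha> = (\<Sum>i | \<alpha> \<le> c' i. c i - \<alpha>) + (\<Sum>i | \<alpha> \<le> c' i. c' i - c i)"
    unfolding excess_def by (simp flip: sum.distrib)
  also have "(\<Sum>i | \<alpha> \<le> c' i. c i - \<alpha>) \<le> excess c \<alpha>"
    using assms by (intro excess_ge finite_level) auto
  finally show ?thesis by simp
qed

lemma sum_half_powers_le:
  fixes \<epsilon> :: real
  assumes "finite F" "0 \<le> \<epsilon>"
  shows "(\<Sum>i\<in>F. \<epsilon> * (1/2)^Suc i) \<le> \<epsilon>"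
proof -
  have "(\<Sum>i\<in>F. (1/2::real)^Suc i) \<le> (\<Sum>i. (1/2::real)^Suc i)"
    using assms power_half_series by (intro sum_le_suminf) (auto simp: sums_iff)
  also have "\<dots> = 1"
    using power_half_series by (simp add: sums_iff)
  finally have "\<epsilon> * (\<Sum>i\<in>F. (1/2)^Suc i) \<le> \<epsilon> * 1"
    using assms by (intro mult_left_mono) auto
  then show ?thesis by (simp add: sum_distrib_left)
qed

text \<open>A changed entry ends up at most \<open>a\<close>, so levels above \<open>a\<close> see
  no increase. This matters because a gap pays for the cost only at small levels.\<close>

lemma excess_small_change:
  assumes c: "c \<longlonglongrightarrow> 0" "c' \<longlonglongrightarrow> 0" and \<alpha>: "0 < \<alpha>" and "0 \<le> \<epsilon>"
    and near: "\<And>i. c' i - c i \<le> \<epsilon> * (1/2)^Suc i"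
    and low: "\<And>i. c' i \<noteq> c i \<Longrightarrow> c' i \<le> a"
  shows "excess c' \<alpha> \<le> excess c \<alpha> + (if \<alpha> \<le> a then \<epsilon> else 0)"
proof (cases "\<alpha> \<le> a")
  case True
  have "(\<Sum>i | \<alpha> \<le> c' i. c' i - c i) \<le> (\<Sum>i | \<alpha> \<le> c' i. \<epsilon> * (1/2)^Suc i)"
    using near by (intro sum_mono) auto
  also have "\<dots> \<le> \<epsilon>"
    using assms by (intro sum_half_powers_le finite_level) auto
  finally show ?thesis
    using excess_change[OF c \<alpha>] True by simp
next
  case False
  then have "c' i = c i" if "\<alpha> \<le> c' i" for i
    using that low[of i] by fastforce
  then have "(\<Sum>i | \<alpha> \<le> c' i. c' i - c i) = 0"
    by (intro sum.neutral) auto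
  then show ?thesis
    using excess_change[OF c \<alpha>] False by simp
qed

text \<open>Every zero with index in \<open>Z\<close> is traded against a small positive entry, downwards
  (\<open>\<kappa> = -1\<close>) or upwards (\<open>\<kappa> = 1\<close>), by summably small amounts.\<close>

lemma eliminate_zeros:
  fixes c :: "nat \<Rightarrow> real" and \<kappa> :: real
  assumes c: "c \<longlonglongrightarrow> 0" and inf: "infinite {i. 0 < c i}"
    and Z: "\<And>i. i \<in> Z \<Longrightarrow> c i = 0" and "0 < a" "0 < \<epsilon>" and \<kappa>: "\<kappa> = 1 \<or> \<kappa> = -1"
  obtains \<phi> c' where "\<And>i. \<phi> (\<phi> i) = i" "\<And>i. c i + c (\<phi> i) = c' i + c' (\<phi> i)"
    "\<kappa> = 1 \<Longrightarrow> \<forall>i. min (c i) (c (\<phi> i)) \<le> c' i \<and> c' i \<le> max (c i) (c (\<phi> i))"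
    "\<kappa> = -1 \<Longrightarrow> \<forall>i. min (c' i) (c' (\<phi> i)) \<le> c i \<and> c i \<le> max (c' i) (c' (\<phi> i))"
    "c' \<longlonglongrightarrow> 0" "\<And>i. 0 < c i \<Longrightarrow> 0 < c' i" "\<And>i. c i < 0 \<Longrightarrow> c' i = c i"
    "\<And>i. i \<in> Z \<Longrightarrow> 0 < \<kappa> * c' i" "\<And>i. i \<notin> Z \<Longrightarrow> c i = 0 \<Longrightarrow> c' i = 0"
    "\<And>\<alpha>. 0 < \<alpha> \<Longrightarrow> \<bar>excess c' \<alpha> - excess c \<alpha>\<bar> \<le> (if \<alpha> \<le> a then \<epsilon> else 0)"
    "\<And>\<alpha>. 0 < \<alpha> \<Longrightarrow> \<bar>excess (\<lambda>i. - c' i) \<alpha> - excess (\<lambda>i. - c i) \<alpha>\<bar> \<le> (if \<alpha> \<le> a then \<epsilon> else 0)"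
proof -
  define Q where "Q = {i. 0 < c i \<and> c i < a / 2}"
  \<comment> \<open>Enumerating in increasing order gives \<open>i \<le> h i\<close>, so a bound
    geometric in \<open>h i\<close> is also geometric in \<open>i\<close>.\<close>
  define h where "h = enumerate Q"
  \<comment> \<open>At most half of \<open>c q\<close>, so that a partner giving up
    \<open>t q\<close> stays positive. The geometric factor keeps the total cost within
    \<open>\<epsilon>\<close>.\<close>
  define t where "t q = min (c q / 2) (min \<epsilon> (a / 2) * (1/2)^Suc q)" for q
  define c' where "c' i = (if i \<in> Z then \<kappa> * t (h i) else if i \<in> h ` Z then c i - \<kappa> * t i else c i)" for i
  define \<phi> where "\<phi> i = (if i \<in> Z then h i else if i \<in> h ` Z then inv h i else i)" for i
  have "{i. 0 < c i} \<subseteq> Q \<union> {i. a / 2 \<le> c i}"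
    by (auto simp: Q_def)
  then have infQ: "infinite Q"
    using inf finite_level[OF c, of "a / 2"] \<open>0 < a\<close> by (meson finite_UnI finite_subset half_gt_zero)
  have h: "h i \<in> Q" "i \<le> h i" for i
    unfolding h_def using infQ by (simp_all add: enumerate_in_set le_enumerate)
  have "inj h"
    unfolding h_def using infQ by (simp add: strict_mono_enumerate strict_mono_imp_inj_on)
  then have inv: "inv h (h i) = i" for i by simp
  have hQ: "0 < c (h i)" "c (h i) < a / 2" for i
    using h(1)[of i] by (auto simp: Q_def)
  have hZ: "h i \<notin> Z" for i
    using hQ(1)[of i] Z by force
  have t: "0 < t (h i)" "t (h i) \<le> c (h i) / 2" "t (h i) \<le> \<epsilon> * (1/2)^Suc (h i)" "t (h i) \<le> a / 2" for i
  proof -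
    show "0 < t (h i)" using hQ(1)[of i] \<open>0 < a\<close> \<open>0 < \<epsilon>\<close> by (simp add: t_def)
    show "t (h i) \<le> c (h i) / 2" by (simp add: t_def)
    have "t (h i) \<le> min \<epsilon> (a / 2) * (1/2)^Suc (h i)" by (simp add: t_def)
    also have "\<dots> \<le> \<epsilon> * (1/2)^Suc (h i)" by (intro mult_right_mono) auto
    finally show "t (h i) \<le> \<epsilon> * (1/2)^Suc (h i)" .
    show "t (h i) \<le> a / 2" using hQ(2)[of i] hQ(1)[of i] \<open>t (h i) \<le> c (h i) / 2\<close> by linarith
  qed
  have onZ: "c z = 0" "c' z = \<kappa> * t (h z)" "\<phi> z = h z"
    "c' (h z) = c (h z) - \<kappa> * t (h z)" "\<phi> (h z) = z" if "z \<in> Z" for z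
    using that Z hZ by (auto simp: c'_def \<phi>_def inv)
  have cases: thesis if "i \<in> Z \<Longrightarrow> thesis" "\<And>z. z \<in> Z \<Longrightarrow> i = h z \<Longrightarrow> thesis"
    "i \<notin> Z \<Longrightarrow> c' i = c i \<Longrightarrow> \<phi> i = i \<Longrightarrow> thesis" for i thesis
  proof (cases "i \<in> Z")
    case True
    then show ?thesis by (rule that(1))
  next
    case False
    then show ?thesis
      using that by (cases "i \<in> h ` Z") (blast, simp add: c'_def \<phi>_def)
  qed
  have near: "\<bar>c' i - c i\<bar> \<le> \<epsilon> * (1/2)^Suc i" for i
  proof (rule cases[of i])
    assume i: "i \<in> Z"
    have "\<epsilon> * (1/2)^Suc (h i) \<le> \<epsilon> * (1/2)^Suc i"
      using h(2)[of i] \<open>0 < \<epsilon>\<close> by (intro mult_left_mono power_decreasing) auto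
    then have "t (h i) \<le> \<epsilon> * (1/2)^Suc i"
      using t(3)[of i] by (rule order_trans[rotated])
    then show ?thesis using onZ[OF i] \<kappa> t(1)[of i] by auto
  next
    fix z assume "z \<in> Z" "i = h z"
    then show ?thesis using \<kappa> t(1)[of z] t(3)[of z] by (auto simp: onZ)
  qed (use \<open>0 < \<epsilon>\<close> in simp)
  have low: "\<bar>c' i\<bar> \<le> a \<and> \<bar>c i\<bar> \<le> a" if "c' i \<noteq> c i" for i
  proof (rule cases[of i])
    assume "i \<in> Z"
    then show ?thesis using \<kappa> t(1,4)[of i] \<open>0 < a\<close> by (auto simp: onZ)
  next
    fix z assume "z \<in> Z" "i = h z"
    then show ?thesis using \<kappa> t(1,2)[of z] hQ[of z] by (auto simp: onZ)
  qed (use that in auto)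
  have bounds: "c' i - c i \<le> \<epsilon> * (1/2)^Suc i" "c i - c' i \<le> \<epsilon> * (1/2)^Suc i"
    "- c' i - - c i \<le> \<epsilon> * (1/2)^Suc i" "- c i - - c' i \<le> \<epsilon> * (1/2)^Suc i"
    "c' i \<noteq> c i \<Longrightarrow> c' i \<le> a" "c i \<noteq> c' i \<Longrightarrow> c i \<le> a"
    "- c' i \<noteq> - c i \<Longrightarrow> - c' i \<le> a" "- c i \<noteq> - c' i \<Longrightarrow> - c i \<le> a" for i
    using near[of i] low[of i] by linarith+
  note change = excess_small_change[OF _ _ _ less_imp_le[OF \<open>0 < \<epsilon>\<close>], where a = a]
  have c'0: "c' \<longlonglongrightarrow> 0"
  proof -
    have "(\<lambda>i. \<epsilon> * (1/2)^Suc i) \<longlonglongrightarrow> 0"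
      by (intro tendsto_mult_right_zero summable_LIMSEQ_zero sums_summable[OF power_half_series])
    then have "(\<lambda>i. c' i - c i) \<longlonglongrightarrow> 0"
      by (rule Lim_null_comparison[rotated]) (intro always_eventually allI, simp only: real_norm_def near)
    from tendsto_add[OF this c] show ?thesis by simp
  qed
  have mc: "(\<lambda>i. - c i) \<longlonglongrightarrow> 0" "(\<lambda>i. - c' i) \<longlonglongrightarrow> 0"
    using tendsto_minus[OF c] tendsto_minus[OF c'0] by simp_all
  show ?thesis
  proof (rule that[of \<phi> c'])
    show "\<phi> (\<phi> i) = i" for i
      by (rule cases[of i]) (simp_all add: onZ)
    show "c i + c (\<phi> i) = c' i + c' (\<phi> i)" for i
      by (rule cases[of i]) (simp_all add: onZ)
    show "\<forall>i. min (c i) (c (\<phi> i)) \<le> c' i \<and> c' i \<le> max (c i) (c (\<phi> i))" if "\<kappa> = 1"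
    proof
      show "min (c i) (c (\<phi> i)) \<le> c' i \<and> c' i \<le> max (c i) (c (\<phi> i))" for i
      proof (rule cases[of i])
        show ?thesis if "i \<in> Z"
          using t(1,2)[of i] hQ(1)[of i] onZ[OF that] \<open>\<kappa> = 1\<close> by auto
        show ?thesis if "z \<in> Z" "i = h z" for z
          using t(1,2)[of z] hQ(1)[of z] onZ[OF that(1)] that(2) \<open>\<kappa> = 1\<close> by auto
      qed simp
    qed
    show "\<forall>i. min (c' i) (c' (\<phi> i)) \<le> c i \<and> c i \<le> max (c' i) (c' (\<phi> i))" if "\<kappa> = -1"
    proof
      show "min (c' i) (c' (\<phi> i)) \<le> c i \<and> c i \<le> max (c' i) (c' (\<phi> i))" for i
      proof (rule cases[of i])
        show ?thesis if "i \<in> Z"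
          using t(1,2)[of i] hQ(1)[of i] onZ[OF that] \<open>\<kappa> = -1\<close> by auto
        show ?thesis if "z \<in> Z" "i = h z" for z
          using t(1,2)[of z] hQ(1)[of z] onZ[OF that(1)] that(2) \<open>\<kappa> = -1\<close> by auto
      qed simp
    qed
    show "c' \<longlonglongrightarrow> 0" by (rule c'0)
    show "0 < c' i" if "0 < c i" for i
    proof (rule cases[of i])
      show ?thesis if "z \<in> Z" "i = h z" for z
        using t(1,2)[of z] hQ(1)[of z] onZ[OF that(1)] that(2) \<kappa> by auto
    qed (use that in \<open>auto simp: onZ\<close>)
    show "c' i = c i" if "c i < 0" for i
    proof (rule cases[of i])
      show ?thesis if "z \<in> Z" "i = h z" for z
        using hQ(1)[of z] that(2) \<open>c i < 0\<close> by auto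
    qed (use that in \<open>auto simp: onZ\<close>)
    show "0 < \<kappa> * c' i" if "i \<in> Z" for i
      using onZ[OF that] t(1)[of i] \<kappa> by auto
    show "c' i = 0" if "i \<notin> Z" "c i = 0" for i
    proof (rule cases[of i])
      show ?thesis if "z \<in> Z" "i = h z" for z
        using hQ(1)[of z] that(2) \<open>c i = 0\<close> by auto
    qed (use that in auto)
    fix \<alpha> :: real assume \<alpha>: "0 < \<alpha>"
    have "excess c' \<alpha> \<le> excess c \<alpha> + (if \<alpha> \<le> a then \<epsilon> else 0)"
      by (rule change[OF c c'0 \<alpha> bounds(1,5)])
    moreover have "excess c \<alpha> \<le> excess c' \<alpha> + (if \<alpha> \<le> a then \<epsilon> else 0)"
      by (rule change[OF c'0 c \<alpha> bounds(2,6)])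
    ultimately show "\<bar>excess c' \<alpha> - excess c \<alpha>\<bar> \<le> (if \<alpha> \<le> a then \<epsilon> else 0)"
      by linarith
    have "excess (\<lambda>i. - c' i) \<alpha> \<le> excess (\<lambda>i. - c i) \<alpha> + (if \<alpha> \<le> a then \<epsilon> else 0)"
      by (rule change[OF mc \<alpha> bounds(3,7)])
    moreover have "excess (\<lambda>i. - c i) \<alpha> \<le> excess (\<lambda>i. - c' i) \<alpha> + (if \<alpha> \<le> a then \<epsilon> else 0)"
      by (rule change[OF mc(2,1) \<alpha> bounds(4,8)])
    ultimately show "\<bar>excess (\<lambda>i. - c' i) \<alpha> - excess (\<lambda>i. - c i) \<alpha>\<bar> \<le> (if \<alpha> \<le> a then \<epsilon> else 0)"
      by linarith
  qed
qed

text \<open>The cap on the next term depends only on the running sum. If that sum stayed bounded,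
  only finitely many caps would occur, the terms would dominate a multiple of the harmonic series,
  and the sum would diverge after all.\<close>

lemma slow_divergence:
  fixes B :: "nat \<Rightarrow> real"
  assumes B: "\<And>m. 0 < B m"
  obtains t where "\<And>k. 0 < t k" "\<And>k. t k \<le> 1" "t \<longlonglongrightarrow> 0" "\<And>C. \<exists>n. C < (\<Sum>k<n. t k)"
    "\<And>k. t k \<le> B (nat \<lceil>\<Sum>j<k. t j\<rceil>)"
proof -
  define S where "S = rec_nat 0 (\<lambda>k s. s + min (1 / real (Suc k)) (B (nat \<lceil>s\<rceil>)))"
  define t where "t k = min (1 / real (Suc k)) (B (nat \<lceil>S k\<rceil>))" for k
  have S: "S k = (\<Sum>j<k. t j)" for k
    by (induction k) (simp_all add: S_def t_def)
  have t_pos: "0 < t k" for k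
    using B by (simp add: t_def)
  have t_le: "t k \<le> 1 / real (Suc k)" for k
    by (simp add: t_def)
  have "t \<longlonglongrightarrow> 0"
  proof (rule Lim_null_comparison[OF always_eventually LIMSEQ_inverse_real_of_nat], rule allI)
    show "norm (t k) \<le> inverse (real (Suc k))" for k
      using t_pos[of k] t_le[of k] by (simp add: inverse_eq_divide del: of_nat_Suc)
  qed
  moreover have "\<exists>n. C < (\<Sum>k<n. t k)" for C
  proof (rule ccontr)
    assume "\<not> ?thesis"
    then have bd: "S k \<le> C" for k
      by (simp add: S not_less)
    have "summable t"
      using bd t_pos by (intro summableI_nonneg_bounded[of t C]) (auto simp: S less_imp_le)
    define b where "b = min 1 (Min (B ` {..nat \<lceil>C\<rceil>}))"
    have "0 < b"
      using B by (simp add: b_def)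
    have "b * inverse (real (Suc k)) \<le> t k" for k
    proof -
      have "nat \<lceil>S k\<rceil> \<in> {..nat \<lceil>C\<rceil>}"
        unfolding atMost_iff using bd[of k] by (intro nat_mono ceiling_mono)
      then have "b \<le> B (nat \<lceil>S k\<rceil>)"
        unfolding b_def by (intro min.coboundedI2 Min_le) auto
      moreover have "b * inverse (real (Suc k)) \<le> b * 1"
        using \<open>0 < b\<close> by (intro mult_left_mono) (auto simp: field_simps)
      moreover have "b * inverse (real (Suc k)) \<le> 1 * inverse (real (Suc k))"
        by (intro mult_right_mono) (auto simp: b_def)
      ultimately show ?thesis
        by (auto simp: t_def inverse_eq_divide)
    qed
    then have "summable (\<lambda>k. b * inverse (real (Suc k)))"
      using \<open>0 < b\<close> by (intro summable_comparison_test'[OF \<open>summable t\<close>, of 0]) auto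
    then have "summable (\<lambda>k. inverse (real (Suc k)))"
      using \<open>0 < b\<close> by (simp add: summable_cmult_iff del: of_nat_Suc)
    then have "summable (\<lambda>k. inverse (real k))"
      by (rule summable_Suc_iff[THEN iffD1])
    then show False
      using not_summable_harmonic[where ?'a = real] by simp
  qed
  moreover have "t k \<le> 1" for k
    using t_le[of k] by (rule order_trans) (simp add: field_simps)
  moreover have "t k \<le> B (nat \<lceil>\<Sum>j<k. t j\<rceil>)" for k
    by (subst S[symmetric]) (simp add: t_def)
  ultimately show ?thesis
    using t_pos by (intro that[of t]) auto
qed

text \<open>One side of the pulling apart; negated sequences give the other. A raised entry is at
  most \<open>3 / 2 * t k\<close>, so it reaches level \<open>\<alpha>\<close> only if
  \<open>\<alpha> / 2 \<le> t k\<close>. The excess therefore grows by at most the sum of these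
  \<open>t k\<close>, which \<open>key\<close> has reserved together with an extra 1.\<close>

lemma excess_pulled_apart:
  fixes l d d' t :: "nat \<Rightarrow> real"
  assumes d: "d \<longlonglongrightarrow> 0" "d' \<longlonglongrightarrow> 0"
    and U: "inj U" "\<And>k. d' (U k) = d (U k) + t k" "\<And>k. \<bar>d (U k)\<bar> \<le> t k / 2"
    and others: "\<And>i. i \<notin> range U \<Longrightarrow> d' i \<le> d i"
    and t: "\<And>k. 0 < t k" "t \<longlonglongrightarrow> 0" "\<And>C. \<exists>n. C < (\<Sum>k<n. t k)"
    and key: "\<And>k \<alpha>. 0 < \<alpha> \<Longrightarrow> \<alpha> \<le> 2 * t k \<Longrightarrow> 1 + (\<Sum>j<Suc k. t j) + excess d \<alpha> \<le> excess l \<alpha>"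
    and base: "\<And>\<alpha>. 0 < \<alpha> \<Longrightarrow> excess d \<alpha> \<le> excess l \<alpha>"
  shows "\<And>\<alpha>. 0 < \<alpha> \<Longrightarrow> excess d' \<alpha> \<le> excess l \<alpha>"
    and "\<exists>a>0. \<forall>\<alpha>. 0 < \<alpha> \<and> \<alpha> \<le> a \<longrightarrow> 1 + excess d' \<alpha> \<le> excess l \<alpha>"
    and "excess_unbounded d'"
proof -
  have change: "excess d' \<alpha> \<le> excess d \<alpha> + (\<Sum>k | \<alpha> / 2 \<le> t k. t k)" if \<alpha>: "0 < \<alpha>" for \<alpha>
  proof -
    let ?F = "{i. \<alpha> \<le> d' i}" and ?K = "{k. \<alpha> / 2 \<le> t k}"
    have fin: "finite ?F" "finite ?K"
      using \<alpha> d t by (auto intro: finite_level)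
    have "(\<Sum>i\<in>?F. d' i - d i) \<le> (\<Sum>i\<in>?F \<inter> U ` ?K. d' i - d i)"
    proof -
      have "d' i - d i \<le> 0" if "i \<in> ?F" "i \<notin> U ` ?K" for i
      proof (cases "i \<in> range U")
        case True
        then obtain k where "i = U k" by blast
        then have "\<alpha> \<le> 3 / 2 * t k" using that U(2)[of k] U(3)[of k] by auto
        then have "\<alpha> / 2 \<le> t k" using t(1)[of k] by linarith
        with that \<open>i = U k\<close> show ?thesis by blast
      qed (use others in auto)
      then show ?thesis
        using fin by (subst sum.inter_restrict) (auto intro!: sum_mono)
    qed
    also have "\<dots> \<le> (\<Sum>i\<in>U ` ?K. d' i - d i)"
      using fin U(2) t(1) by (intro sum_mono2) (auto intro: less_imp_le)
    also have "\<dots> = (\<Sum>k\<in>?K. t k)"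
      using U by (subst sum.reindex) (auto intro: inj_on_subset)
    finally show ?thesis
      using excess_change[OF d \<alpha>] by linarith
  qed
  have gain: "1 + excess d' \<alpha> \<le> excess l \<alpha>" if \<alpha>: "0 < \<alpha>" and k: "\<alpha> / 2 \<le> t k" for \<alpha> k
  proof -
    let ?K = "{k. \<alpha> / 2 \<le> t k}"
    have fin: "finite ?K" using \<alpha> t by (intro finite_level) auto
    define m where "m = Max ?K"
    have "m \<in> ?K" unfolding m_def using fin k by (intro Max_in) auto
    have "(\<Sum>k\<in>?K. t k) \<le> (\<Sum>k<Suc m. t k)"
    proof (rule sum_mono2)
      show "?K \<subseteq> {..<Suc m}" using fin by (auto simp: m_def less_Suc_eq_le)
    qed (use t in \<open>auto intro: less_imp_le\<close>)
    then show ?thesis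
      using change[OF \<alpha>] key[of \<alpha> m] \<alpha> \<open>m \<in> ?K\<close> by simp
  qed
  show "excess d' \<alpha> \<le> excess l \<alpha>" if \<alpha>: "0 < \<alpha>" for \<alpha>
  proof (cases "\<exists>k. \<alpha> / 2 \<le> t k")
    case True
    then show ?thesis using gain[OF \<alpha>] by fastforce
  next
    case False
    then show ?thesis using change[OF \<alpha>] base[OF \<alpha>] by simp
  qed
  show "\<exists>a>0. \<forall>\<alpha>. 0 < \<alpha> \<and> \<alpha> \<le> a \<longrightarrow> 1 + excess d' \<alpha> \<le> excess l \<alpha>"
    using t(1)[of 0] gain[of _ 0] by (intro exI[of _ "t 0"]) auto
  show "excess_unbounded d'"
    unfolding excess_unbounded_def
  proof
    fix C :: real
    \<comment> \<open>A raised entry is only known to be at least \<open>t k / 2\<close>, hence the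
      factor 2. The extra 1 pays for subtracting \<open>\<alpha>\<close> from \<open>n\<close>
      entries.\<close>
    obtain n where n: "2 * (C + 1) < (\<Sum>k<n. t k)" using t(3) by blast
    define \<alpha> where "\<alpha> = 1 / real (Suc n)"
    have \<alpha>: "0 < \<alpha>" "real n * \<alpha> \<le> 1" by (auto simp: \<alpha>_def field_simps)
    have "C < (\<Sum>k<n. t k / 2) - real n * \<alpha>"
      using n \<alpha>(2) by (simp flip: sum_divide_distrib)
    also have "\<dots> = (\<Sum>k<n. t k / 2 - \<alpha>)"
      by (simp add: sum_subtractf)
    also have "\<dots> \<le> (\<Sum>k<n. d' (U k) - \<alpha>)"
    proof (intro sum_mono diff_right_mono)
      show "t k / 2 \<le> d' (U k)" for k
        using U(3)[of k] by (simp add: U(2) abs_le_iff)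
    qed
    also have "\<dots> = (\<Sum>i\<in>U ` {..<n}. d' i - \<alpha>)"
      using U(1) by (subst sum.reindex) (auto intro: inj_on_subset)
    also have "\<dots> \<le> excess d' \<alpha>"
      using d \<alpha> by (intro excess_ge) auto
    finally show "\<exists>\<alpha>>0. C < excess d' \<alpha>" using \<alpha> by blast
  qed
qed

text \<open>The amounts \<open>t k\<close> have a divergent sum, which makes both halves of
  \<open>d'\<close> diverge, but they grow up so slowly that the gap at the affected levels always
  exceeds what has been spent.\<close>

lemma pull_pairs_apart:
  fixes l d :: "nat \<Rightarrow> real"
  assumes d: "d \<longlonglongrightarrow> 0"
    and base: "\<And>\<alpha>. 0 < \<alpha> \<Longrightarrow> excess d \<alpha> \<le> excess l \<alpha>"
      "\<And>\<alpha>. 0 < \<alpha> \<Longrightarrow> excess (\<lambda>i. - d i) \<alpha> \<le> excess (\<lambda>i. - l i) \<alpha>"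
    and big: "\<And>s. \<exists>a>0. \<forall>\<alpha>. 0 < \<alpha> \<and> \<alpha> \<le> a \<longrightarrow> s + excess d \<alpha> \<le> excess l \<alpha>"
      "\<And>s. \<exists>a>0. \<forall>\<alpha>. 0 < \<alpha> \<and> \<alpha> \<le> a \<longrightarrow> s + excess (\<lambda>i. - d i) \<alpha> \<le> excess (\<lambda>i. - l i) \<alpha>"
  obtains \<phi> d' where "\<And>i. \<phi> (\<phi> i) = i" "\<And>i. d' i + d' (\<phi> i) = d i + d (\<phi> i)"
    "\<And>i. min (d' i) (d' (\<phi> i)) \<le> d i" "\<And>i. d i \<le> max (d' i) (d' (\<phi> i))" "d' \<longlonglongrightarrow> 0"
    "\<And>\<alpha>. 0 < \<alpha> \<Longrightarrow> excess d' \<alpha> \<le> excess l \<alpha>"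
    "\<And>\<alpha>. 0 < \<alpha> \<Longrightarrow> excess (\<lambda>i. - d' i) \<alpha> \<le> excess (\<lambda>i. - l i) \<alpha>"
    "\<exists>a>0. \<forall>\<alpha>. 0 < \<alpha> \<and> \<alpha> \<le> a \<longrightarrow> 1 + excess d' \<alpha> \<le> excess l \<alpha>"
    "\<exists>a>0. \<forall>\<alpha>. 0 < \<alpha> \<and> \<alpha> \<le> a \<longrightarrow> 1 + excess (\<lambda>i. - d' i) \<alpha> \<le> excess (\<lambda>i. - l i) \<alpha>"
    "excess_unbounded d'" "excess_unbounded (\<lambda>i. - d' i)"
proof -
  obtain A1 where A1: "\<And>s. 0 < A1 s"
    "\<And>s \<alpha>. 0 < \<alpha> \<Longrightarrow> \<alpha> \<le> A1 s \<Longrightarrow> s + excess d \<alpha> \<le> excess l \<alpha>"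
    using big(1) by metis
  obtain A2 where A2: "\<And>s. 0 < A2 s"
    "\<And>s \<alpha>. 0 < \<alpha> \<Longrightarrow> \<alpha> \<le> A2 s \<Longrightarrow> s + excess (\<lambda>i. - d i) \<alpha> \<le> excess (\<lambda>i. - l i) \<alpha>"
    using big(2) by metis
  \<comment> \<open>\<open>m + 2\<close> covers the reserve 1, the running sum rounded up to
    \<open>m\<close>, and the next term, which is at most 1. Halving is needed because levels up to
    \<open>2 * t k\<close> are affected.\<close>
  define B where "B m = min (A1 (real m + 2)) (A2 (real m + 2)) / 2" for m :: nat
  have "0 < B m" for m
    using A1(1) A2(1) by (simp add: B_def)
  then obtain t where t: "\<And>k. 0 < t k" "\<And>k. t k \<le> 1" "t \<longlonglongrightarrow> 0" "\<And>C. \<exists>n. C < (\<Sum>k<n. t k)"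
    and tB: "\<And>k. t k \<le> B (nat \<lceil>\<Sum>j<k. t j\<rceil>)"
    using slow_divergence[of B] by blast
  have key: "1 + (\<Sum>j<Suc k. t j) + excess d \<alpha> \<le> excess l \<alpha>"
    "1 + (\<Sum>j<Suc k. t j) + excess (\<lambda>i. - d i) \<alpha> \<le> excess (\<lambda>i. - l i) \<alpha>"
    if "0 < \<alpha>" "\<alpha> \<le> 2 * t k" for k \<alpha>
  proof -
    define m where "m = nat \<lceil>\<Sum>j<k. t j\<rceil>"
    have "(\<Sum>j<k. t j) \<le> real m"
      unfolding m_def by (rule real_nat_ceiling_ge)
    then have "1 + (\<Sum>j<Suc k. t j) \<le> real m + 2"
      using t(2)[of k] by simp
    moreover have "\<alpha> \<le> A1 (real m + 2)" "\<alpha> \<le> A2 (real m + 2)"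
      using tB[of k] that by (auto simp: B_def m_def)
    ultimately show "1 + (\<Sum>j<Suc k. t j) + excess d \<alpha> \<le> excess l \<alpha>"
      "1 + (\<Sum>j<Suc k. t j) + excess (\<lambda>i. - d i) \<alpha> \<le> excess (\<lambda>i. - l i) \<alpha>"
      using A1(2)[of \<alpha> "real m + 2"] A2(2)[of \<alpha> "real m + 2"] that by auto
  qed
  have "\<exists>n. \<forall>i\<ge>n. \<bar>d i\<bar> \<le> t k / 2" for k
    using LIMSEQ_D[OF d, of "t k / 2"] t(1)[of k] by (auto intro: less_imp_le)
  then obtain n0 where n0: "\<And>k i. n0 k \<le> i \<Longrightarrow> \<bar>d i\<bar> \<le> t k / 2"
    by metis
  \<comment> \<open>The \<open>k\<close>-th pair is \<open>N k\<close> and its successor; steps of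
    at least 2 keep the pairs disjoint, and \<open>n0 k\<close> makes both entries small compared
    with \<open>t k\<close>.\<close>
  define N where "N = rec_nat (n0 0) (\<lambda>k n. max (n + 2) (n0 (Suc k)))"
  have NS: "N (Suc k) = max (N k + 2) (n0 (Suc k))" for k
    by (simp add: N_def)
  have Nn0: "n0 k \<le> N k" for k
    by (cases k) (simp_all add: N_def)
  have N_gap: "N m + 2 \<le> N k" if "m < k" for m k
    using that
  proof (induction k)
    case (Suc k)
    then show ?case by (cases "m = k") (auto simp: NS)
  qed simp
  \<comment> \<open>The larger entry of the pair is raised and the smaller lowered, so the old
    values lie between the new ones.\<close>
  define u where "u k = (if d (N k) \<le> d (Suc (N k)) then Suc (N k) else N k)" for k
  define v where "v k = (if d (N k) \<le> d (Suc (N k)) then N k else Suc (N k))" for k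
  have uv: "u k = N k \<and> v k = Suc (N k) \<or> u k = Suc (N k) \<and> v k = N k" for k
    by (simp add: u_def v_def)
  have d_uv: "d (v k) \<le> d (u k)" for k
    by (simp add: u_def v_def)
  have small: "\<bar>d (u k)\<bar> \<le> t k / 2" "\<bar>d (v k)\<bar> \<le> t k / 2" for k
    using n0[of k "u k"] n0[of k "v k"] Nn0[of k] uv[of k] by auto
  have sep: "m = k" if "i \<in> {N m, Suc (N m)}" "i \<in> {N k, Suc (N k)}" for i m k
    using that N_gap[of m k] N_gap[of k m] by (cases m k rule: linorder_cases) auto
  have inN: "u k \<in> {N k, Suc (N k)}" "v k \<in> {N k, Suc (N k)}" for k
    using uv[of k] by auto
  have inj: "inj u" "inj v"
  proof -
    show "inj u"
    proof (rule injI)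
      show "m = k" if "u m = u k" for m k
        using sep[of "u m" m k] inN(1)[of m] inN(1)[of k] that by simp
    qed
    show "inj v"
    proof (rule injI)
      show "m = k" if "v m = v k" for m k
        using sep[of "v m" m k] inN(2)[of m] inN(2)[of k] that by simp
    qed
  qed
  have disj: "u k \<noteq> v m" for k m
  proof
    assume eq: "u k = v m"
    then have "k = m" using sep[of "u k" k m] inN[of k] inN[of m] by simp
    then show False using eq uv[of k] by auto
  qed
  define d' where "d' i = (if i \<in> range u then d i + t (inv u i)
      else if i \<in> range v then d i - t (inv v i) else d i)" for i
  define \<phi> where "\<phi> i = (if i \<in> range u then v (inv u i)
      else if i \<in> range v then u (inv v i) else i)" for i
  have vals: "d' (u k) = d (u k) + t k" "d' (v k) = d (v k) - t k" "\<phi> (u k) = v k" "\<phi> (v k) = u k" for k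
  proof -
    have "v k \<notin> range u" using disj[of _ k] by (metis imageE)
    then show "d' (u k) = d (u k) + t k" "d' (v k) = d (v k) - t k" "\<phi> (u k) = v k" "\<phi> (v k) = u k"
      using inj by (simp_all add: d'_def \<phi>_def)
  qed
  have cases: thesis if "\<And>k. i = u k \<Longrightarrow> thesis" "\<And>k. i = v k \<Longrightarrow> thesis"
    "i \<notin> range u \<Longrightarrow> i \<notin> range v \<Longrightarrow> d' i = d i \<Longrightarrow> \<phi> i = i \<Longrightarrow> thesis" for i thesis
  proof (cases "i \<in> range u \<or> i \<in> range v")
    case True
    then show ?thesis using that(1,2) by blast
  next
    case False
    then show ?thesis by (intro that(3)) (simp_all add: d'_def \<phi>_def)
  qed
  have d'0: "d' \<longlonglongrightarrow> 0"
    unfolding null_sequence_iff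
  proof (intro allI impI)
    fix \<epsilon> :: real assume "0 < \<epsilon>"
    let ?K = "{k. \<epsilon> / 2 \<le> t k}"
    have "i \<in> {i. \<epsilon> \<le> \<bar>d i\<bar>} \<union> u ` ?K \<union> v ` ?K" if i: "\<epsilon> \<le> \<bar>d' i\<bar>" for i
    proof (rule cases[of i])
      fix k assume "i = u k"
      moreover from this have "\<epsilon> / 2 \<le> t k" using i small(1)[of k] t(1)[of k] by (auto simp: vals)
      ultimately show ?thesis by blast
    next
      fix k assume "i = v k"
      moreover from this have "\<epsilon> / 2 \<le> t k" using i small(2)[of k] t(1)[of k] by (auto simp: vals)
      ultimately show ?thesis by blast
    qed (use i in auto)
    then have "{i. \<epsilon> \<le> \<bar>d' i\<bar>} \<subseteq> {i. \<epsilon> \<le> \<bar>d i\<bar>} \<union> u ` ?K \<union> v ` ?K"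
      by blast
    moreover have "finite ({i. \<epsilon> \<le> \<bar>d i\<bar>} \<union> u ` ?K \<union> v ` ?K)"
      using \<open>0 < \<epsilon>\<close> d by (intro finite_UnI finite_imageI finite_level[OF t(3)]) (simp_all add: null_sequence_iff)
    ultimately show "finite {i. \<epsilon> \<le> \<bar>d' i\<bar>}"
      by (rule finite_subset)
  qed
  have le: "d' i \<le> d i" if "i \<notin> range u" for i
    by (rule cases[of i]) (use that t(1) in \<open>auto simp: vals less_imp_le\<close>)
  have ge: "- d' i \<le> - d i" if "i \<notin> range v" for i
    by (rule cases[of i]) (use that t(1) in \<open>auto simp: vals less_imp_le\<close>)
  note plus = excess_pulled_apart[OF d d'0 inj(1) vals(1) small(1) le t(1,3,4) key(1) base(1)]
  have small_v: "\<bar>- d (v k)\<bar> \<le> t k / 2" and vals_v: "- d' (v k) = - d (v k) + t k" for k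
    using small(2) by (simp_all add: vals)
  have m0: "(\<lambda>i. - d i) \<longlonglongrightarrow> 0" "(\<lambda>i. - d' i) \<longlonglongrightarrow> 0"
    using tendsto_minus[OF d] tendsto_minus[OF d'0] by simp_all
  note minus = excess_pulled_apart[OF m0 inj(2) vals_v small_v ge t(1,3,4) key(2) base(2)]
  show ?thesis
  proof (rule that[of \<phi> d'])
    show "\<phi> (\<phi> i) = i" for i
      by (rule cases[of i]) (simp_all add: vals)
    show "d' i + d' (\<phi> i) = d i + d (\<phi> i)" for i
      by (rule cases[of i]) (simp_all add: vals)
    show "min (d' i) (d' (\<phi> i)) \<le> d i" for i
    proof (rule cases[of i])
      show ?thesis if "i = u k" for k using that d_uv[of k] t(1)[of k] by (simp add: vals min_def)
      show ?thesis if "i = v k" for k using that d_uv[of k] t(1)[of k] by (simp add: vals min_def)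
    qed simp
    show "d i \<le> max (d' i) (d' (\<phi> i))" for i
    proof (rule cases[of i])
      show ?thesis if "i = u k" for k using that d_uv[of k] t(1)[of k] by (simp add: vals max_def)
      show ?thesis if "i = v k" for k using that d_uv[of k] t(1)[of k] by (simp add: vals max_def)
    qed simp
  qed (use d'0 plus minus in auto)
qed

section \<open>Moving diagonals\<close>

lemma null_sequence_inj:
  fixes c :: "nat \<Rightarrow> real"
  assumes "c \<longlonglongrightarrow> 0" "inj \<sigma>"
  shows "(\<lambda>n. c (\<sigma> n)) \<longlonglongrightarrow> 0"
proof -
  have "finite (\<sigma> -` {i. \<epsilon> \<le> \<bar>c i\<bar>})" if "0 < \<epsilon>" for \<epsilon>
    using assms that by (intro finite_vimageI) (auto simp: null_sequence_iff)
  then show ?thesis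
    by (simp add: null_sequence_iff vimage_def)
qed

lemma excess_unbounded_infinite:
  assumes "excess_unbounded c"
  shows "infinite {i. 0 < c i}"
proof
  assume fin: "finite {i. 0 < c i}"
  obtain \<alpha> where \<alpha>: "0 < \<alpha>" "(\<Sum>i | 0 < c i. c i) < excess c \<alpha>"
    using assms by (auto simp: excess_unbounded_def)
  have "excess c \<alpha> \<le> (\<Sum>i | \<alpha> \<le> c i. c i)"
    unfolding excess_def using \<alpha> by (intro sum_mono) auto
  also have "\<dots> \<le> (\<Sum>i | 0 < c i. c i)"
    using \<alpha> by (intro sum_mono2 fin) auto
  finally show False using \<alpha> by simp
qed

lemma diagonal_move_positive:
  fixes E :: "'h::complex_inner \<Rightarrow> 'h"
  assumes sa: "selfadjoint_operator E" and l: "l \<longlonglongrightarrow> 0" and d: "d \<longlonglongrightarrow> 0"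
    and unb: "excess_unbounded d" and le: "\<And>\<alpha>. 0 < \<alpha> \<Longrightarrow> excess d \<alpha> \<le> excess l \<alpha>"
  shows "diagonal_move E {i. 0 < l i} l {i. 0 < d i} d"
proof -
  have "excess_unbounded l"
    using unb le unfolding excess_unbounded_def by (meson less_le_trans)
  have sorted: "\<exists>\<sigma>. bij_betw \<sigma> UNIV {i. 0 < c i} \<and> decseq (\<lambda>n. c (\<sigma> n))"
    if "c \<longlonglongrightarrow> 0" "excess_unbounded c" for c
  proof (rule sort_decreasing[of "{i. 0 < c i}" c])
    show "finite {i \<in> {i. 0 < c i}. \<alpha> \<le> c i}" if "0 < \<alpha>" for \<alpha>
      using finite_level[OF \<open>c \<longlonglongrightarrow> 0\<close> that] by (rule rev_finite_subset) auto
  qed (use excess_unbounded_infinite that in auto)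
  obtain \<tau> where \<tau>: "bij_betw \<tau> UNIV {i. 0 < l i}" "decseq (\<lambda>n. l (\<tau> n))"
    using sorted[OF l \<open>excess_unbounded l\<close>] by blast
  obtain \<upsilon> where \<upsilon>: "bij_betw \<upsilon> UNIV {i. 0 < d i}" "decseq (\<lambda>n. d (\<upsilon> n))"
    using sorted[OF d unb] by blast
  have inj: "inj \<tau>" "inj \<upsilon>" and range: "range \<tau> = {i. 0 < l i}" "range \<upsilon> = {i. 0 < d i}"
    using \<tau> \<upsilon> by (auto simp: bij_betw_def)
  have l_pos: "0 < l (\<tau> n)" and d_pos: "0 < d (\<upsilon> n)" for n
    using range by auto
  have dec: "l (\<tau> n) \<le> l (\<tau> m)" if "m \<le> n" for m n
    using \<tau>(2) that by (simp add: decseq_def)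
  have major: "(\<Sum>i<n. d (\<upsilon> i)) \<le> (\<Sum>i<n. l (\<tau> i))" for n
  proof -
    \<comment> \<open>At the level of the entry following the first \<open>n\<close>, the excess of
      \<open>l\<close> is at most the contribution of these \<open>n\<close> entries, and the
      multiples of \<open>\<alpha>\<close> cancel against those for \<open>d\<close>.\<close>
    define \<alpha> where "\<alpha> = l (\<tau> n)"
    have \<alpha>: "0 < \<alpha>" using l_pos by (simp add: \<alpha>_def)
    let ?T = "\<tau> ` {..<n}"
    have "l i = \<alpha>" if i: "\<alpha> \<le> l i" "i \<notin> ?T" for i
    proof -
      have "i \<in> range \<tau>" using i \<alpha> range by simp
      then obtain k where k: "i = \<tau> k" by blast
      then have "n \<le> k" using i(2) by (cases "k < n") auto
      then show ?thesis using dec[of n k] i k by (simp add: \<alpha>_def)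
    qed
    then have "excess l \<alpha> = (\<Sum>i\<in>{i. \<alpha> \<le> l i} \<inter> ?T. l i - \<alpha>)"
      unfolding excess_def using finite_level[OF l \<alpha>] by (intro sum.mono_neutral_right) auto
    also have "\<dots> \<le> (\<Sum>i\<in>?T. l i - \<alpha>)"
      using dec by (intro sum_mono2) (auto simp: \<alpha>_def)
    also have "\<dots> = (\<Sum>i<n. l (\<tau> i) - \<alpha>)"
      using inj by (subst sum.reindex) (auto intro: inj_on_subset)
    finally have "excess l \<alpha> \<le> (\<Sum>i<n. l (\<tau> i) - \<alpha>)" .
    moreover have "(\<Sum>i<n. d (\<upsilon> i) - \<alpha>) = (\<Sum>i\<in>\<upsilon> ` {..<n}. d i - \<alpha>)"
      using inj by (subst sum.reindex) (auto intro: inj_on_subset)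
    moreover have "\<dots> \<le> excess d \<alpha>"
      by (intro excess_ge d \<alpha>) auto
    ultimately show ?thesis
      using le[OF \<alpha>] by (simp add: sum_subtractf)
  qed
  have d_sum: "\<exists>n. C < (\<Sum>i<n. d (\<upsilon> i))" for C
  proof -
    obtain \<alpha> where \<alpha>: "0 < \<alpha>" "C < excess d \<alpha>"
      using unb by (auto simp: excess_unbounded_def)
    let ?P = "\<upsilon> -` {i. \<alpha> \<le> d i}"
    have P: "finite ?P" using finite_level[OF d \<alpha>(1)] inj(2) by (rule finite_vimageI)
    then obtain n where n: "?P \<subseteq> {..<n}" by (auto simp: finite_nat_iff_bounded)
    have "{i. \<alpha> \<le> d i} = \<upsilon> ` ?P"
      unfolding image_vimage_eq range using \<alpha>(1) by auto
    then have "excess d \<alpha> = (\<Sum>i\<in>\<upsilon> ` ?P. d i - \<alpha>)"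
      unfolding excess_def by (rule sum.cong) simp
    also have "\<dots> = (\<Sum>k\<in>?P. d (\<upsilon> k) - \<alpha>)"
      by (subst sum.reindex) (auto intro: inj_on_subset[OF inj(2)])
    also have "\<dots> \<le> (\<Sum>k\<in>?P. d (\<upsilon> k))"
      using \<alpha> by (intro sum_mono) auto
    also have "\<dots> \<le> (\<Sum>k<n. d (\<upsilon> k))"
      using n d_pos by (intro sum_mono2) (auto intro: less_imp_le)
    finally show ?thesis using \<alpha>(2) by (intro exI[of _ n]) linarith
  qed
  \<comment> \<open>The sorting of \<open>l\<close> is given up for tightness here; the chain
    requires only \<open>d\<close> to be decreasing.\<close>
  obtain \<pi> where \<pi>: "bij \<pi>" "\<And>n. (\<Sum>i<n. d (\<upsilon> i)) \<le> (\<Sum>i<n. l (\<tau> (\<pi> i)))"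
    "\<And>N. \<exists>n\<ge>N. (\<Sum>i<n. l (\<tau> (\<pi> i))) < (\<Sum>i<n. d (\<upsilon> i)) + d (\<upsilon> n)"
    using reorder_slack[of "\<lambda>n. l (\<tau> n)" "\<lambda>n. d (\<upsilon> n)", OF l_pos null_sequence_inj[OF l inj(1)] d_sum major]
    by metis
  have "(\<lambda>n. l (\<tau> (\<pi> n))) \<longlonglongrightarrow> 0"
    using \<pi>(1) by (intro null_sequence_inj[of "\<lambda>n. l (\<tau> n)" \<pi>] null_sequence_inj[OF l inj(1)]) (simp add: bij_def)
  then obtain \<sigma> p x where \<sigma>: "bij \<sigma>" and p: "\<And>n. 0 \<le> p n" "\<And>n. p n \<le> 1"
    and x: "x 0 = l (\<tau> (\<pi> (\<sigma> 0)))" "\<And>n. x (Suc n) = (1 - p n) * x n + p n * l (\<tau> (\<pi> (\<sigma> (Suc n))))"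
    and d_eq: "\<And>n. d (\<upsilon> n) = p n * x n + (1 - p n) * l (\<tau> (\<pi> (\<sigma> (Suc n))))"
    and lim: "\<And>m. (\<lambda>n. \<Prod>k=m..<m+n. 1 - p k) \<longlonglongrightarrow> 0"
    using chain_parameters[of "\<lambda>n. l (\<tau> (\<pi> n))" "\<lambda>n. d (\<upsilon> n)", OF l_pos _ d_pos \<upsilon>(2) null_sequence_inj[OF d inj(2)] \<pi>(2,3)]
    by metis
  have "diagonal_move E UNIV (\<lambda>n. l (\<tau> (\<pi> (\<sigma> n)))) UNIV (\<lambda>n. d (\<upsilon> n))"
    unfolding d_eq by (rule diagonal_move_chain[OF sa p x lim])
  moreover have "bij_betw (\<lambda>n. \<tau> (\<pi> (\<sigma> n))) UNIV {i. 0 < l i}"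
    using bij_betw_trans[OF bij_betw_trans[OF \<sigma> \<pi>(1)] \<tau>(1)] by (simp add: comp_def)
  then have "diagonal_move E {i. 0 < l i} l UNIV (\<lambda>n. l (\<tau> (\<pi> (\<sigma> n))))"
    by (rule diagonal_move_bij) simp
  moreover have "diagonal_move E UNIV (\<lambda>n. d (\<upsilon> n)) {i. 0 < d i} d"
    using \<upsilon>(1) by (intro diagonal_move_bij[OF bij_betw_inv_into[OF \<upsilon>(1)]])
      (simp add: bij_betw_inv_into_right)
  ultimately show ?thesis
    by (meson diagonal_move_trans)
qed

lemma diagonal_move_balanced:
  fixes E :: "'h::complex_inner \<Rightarrow> 'h" and l d :: "nat \<Rightarrow> real"
  assumes sa: "selfadjoint_operator E" and l: "l \<longlonglongrightarrow> 0" and d: "d \<longlonglongrightarrow> 0"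
    and unb: "excess_unbounded d" "excess_unbounded (\<lambda>i. - d i)"
    and le: "\<And>\<alpha>. 0 < \<alpha> \<Longrightarrow> excess d \<alpha> \<le> excess l \<alpha>"
      "\<And>\<alpha>. 0 < \<alpha> \<Longrightarrow> excess (\<lambda>i. - d i) \<alpha> \<le> excess (\<lambda>i. - l i) \<alpha>"
    and zeros: "bij_betw f {i. d i = 0} {i. l i = 0}"
  shows "diagonal_move E UNIV l UNIV d"
proof -
  have pos: "diagonal_move E {i. 0 < l i} l {i. 0 < d i} d"
    by (rule diagonal_move_positive[OF sa l d unb(1) le(1)])
  have "(\<lambda>i. - l i) \<longlonglongrightarrow> 0" "(\<lambda>i. - d i) \<longlonglongrightarrow> 0"
    using tendsto_minus[OF l] tendsto_minus[OF d] by simp_all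
  then have "diagonal_move (\<lambda>x. - E x) {i. 0 < - l i} (\<lambda>i. - l i) {i. 0 < - d i} (\<lambda>i. - d i)"
    by (rule diagonal_move_positive[OF selfadjoint_uminus[OF sa] _ _ unb(2) le(2)])
  then have neg: "diagonal_move E {i. l i < 0} l {i. d i < 0} d"
    unfolding neg_0_less_iff_less by (rule diagonal_move_uminus)
  have zero: "diagonal_move E {i. l i = 0} l {i. d i = 0} d"
    by (rule diagonal_move_bij[OF zeros]) (use zeros in \<open>auto simp: bij_betw_def\<close>)
  have "{i. 0 < c i} \<union> {i. c i < 0} \<union> {i. c i = 0} = UNIV" for c :: "nat \<Rightarrow> real"
    by auto
  moreover have "diagonal_move E ({i. 0 < l i} \<union> {i. l i < 0} \<union> {i. l i = 0}) l
      ({i. 0 < d i} \<union> {i. d i < 0} \<union> {i. d i = 0}) d"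
    by (intro diagonal_move_Un pos neg zero) auto
  ultimately show ?thesis by simp
qed

text \<open>A real-valued substitute for comparing \<open>s\<close> with \<open>sigma_plus\<close>:
  it follows from \<open>s < sigma_plus\<close> and implies \<open>s \<le> sigma_plus\<close>.
  Negated sequences give the version for \<open>sigma_minus\<close>.\<close>

definition excess_gap :: "real \<Rightarrow> (nat \<Rightarrow> real) \<Rightarrow> (nat \<Rightarrow> real) \<Rightarrow> bool" where
  "excess_gap s l d \<longleftrightarrow> (\<exists>a>0. \<forall>\<alpha>. 0 < \<alpha> \<and> \<alpha> \<le> a \<longrightarrow> s + excess d \<alpha> \<le> excess l \<alpha>)"

lemma excess_unbounded_perturb:
  assumes "excess_unbounded d" "\<And>\<alpha>. 0 < \<alpha> \<Longrightarrow> excess d \<alpha> \<le> excess d' \<alpha> + \<epsilon>"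
  shows "excess_unbounded d'"
  unfolding excess_unbounded_def
proof
  fix C :: real
  obtain \<alpha> where "0 < \<alpha>" "C + \<epsilon> < excess d \<alpha>"
    using assms(1) unfolding excess_unbounded_def by blast
  then show "\<exists>\<alpha>>0. C < excess d' \<alpha>"
    using assms(2)[of \<alpha>] by (intro exI[of _ \<alpha>]) simp
qed

text \<open>Zeros of \<open>l\<close> that are not needed for \<open>d\<close> are absorbed on the side where there is a gap.\<close>

lemma diagonal_move_one_gap:
  fixes E :: "'h::complex_inner \<Rightarrow> 'h" and l d :: "nat \<Rightarrow> real"
  assumes sa: "selfadjoint_operator E" and l: "l \<longlonglongrightarrow> 0" and d: "d \<longlonglongrightarrow> 0"
    and unb: "excess_unbounded d" "excess_unbounded (\<lambda>i. - d i)"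
    and le: "\<And>\<alpha>. 0 < \<alpha> \<Longrightarrow> excess d \<alpha> \<le> excess l \<alpha>"
      "\<And>\<alpha>. 0 < \<alpha> \<Longrightarrow> excess (\<lambda>i. - d i) \<alpha> \<le> excess (\<lambda>i. - l i) \<alpha>"
    and gap: "excess_gap s l d" "0 < s"
    and zeros: "bij_betw f {i. d i = 0} Z0" "Z0 \<subseteq> {i. l i = 0}"
  shows "diagonal_move E UNIV l UNIV d"
proof -
  obtain a where a: "0 < a" "\<And>\<alpha>. 0 < \<alpha> \<Longrightarrow> \<alpha> \<le> a \<Longrightarrow> s + excess d \<alpha> \<le> excess l \<alpha>"
    using gap(1) by (auto simp: excess_gap_def)
  have "excess_unbounded l"
    using unb(1) le(1) by (intro excess_unbounded_perturb[of d l 0]) auto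
  then have inf: "infinite {i. 0 < l i}"
    by (rule excess_unbounded_infinite)
  show ?thesis
  proof (rule eliminate_zeros[OF l inf, of "{i. l i = 0} - Z0" a s 1])
    show "l i = 0" if "i \<in> {i. l i = 0} - Z0" for i using that by simp
  next
    fix \<phi> l'
    assume \<phi>: "\<And>i. \<phi> (\<phi> i) = i" "\<And>i. l i + l (\<phi> i) = l' i + l' (\<phi> i)"
        "(1::real) = 1 \<Longrightarrow> \<forall>i. min (l i) (l (\<phi> i)) \<le> l' i \<and> l' i \<le> max (l i) (l (\<phi> i))"
      and l'0: "l' \<longlonglongrightarrow> 0"
      and signs: "\<And>i. 0 < l i \<Longrightarrow> 0 < l' i" "\<And>i. l i < 0 \<Longrightarrow> l' i = l i"
        "\<And>i. i \<in> {i. l i = 0} - Z0 \<Longrightarrow> 0 < 1 * l' i" "\<And>i. i \<notin> {i. l i = 0} - Z0 \<Longrightarrow> l i = 0 \<Longrightarrow> l' i = 0"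
      and near: "\<And>\<alpha>. 0 < \<alpha> \<Longrightarrow> \<bar>excess l' \<alpha> - excess l \<alpha>\<bar> \<le> (if \<alpha> \<le> a then s else 0)"
    have sgn_l': "(0 < l i \<and> 0 < l' i) \<or> (l i < 0 \<and> l' i = l i) \<or> (l i = 0 \<and> i \<in> Z0 \<and> l' i = 0) \<or>
        (l i = 0 \<and> i \<notin> Z0 \<and> 0 < l' i)" for i
      using signs[of i] by (cases "l i" "0::real" rule: linorder_cases; cases "i \<in> Z0") simp_all
    have "diagonal_move E UNIV l UNIV l'"
      using \<phi> by (intro diagonal_move_involution[OF sa \<phi>(1)]) auto
    moreover have "diagonal_move E UNIV l' UNIV d"
    proof (rule diagonal_move_balanced[OF sa l'0 d unb])
      fix \<alpha> :: real assume \<alpha>: "0 < \<alpha>"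
      \<comment> \<open>Contracting \<open>l\<close> costs at most \<open>s\<close>, and only at
        levels up to \<open>a\<close>, where the gap pays for it.\<close>
      show "excess d \<alpha> \<le> excess l' \<alpha>"
        using near[OF \<alpha>] a(2)[OF \<alpha>] le(1)[OF \<alpha>] by (cases "\<alpha> \<le> a") auto
      have "\<alpha> \<le> - l' i \<longleftrightarrow> \<alpha> \<le> - l i" "\<alpha> \<le> - l i \<Longrightarrow> l' i = l i" for i
        using sgn_l'[of i] \<alpha> by linarith+
      then have "excess (\<lambda>i. - l' i) \<alpha> = excess (\<lambda>i. - l i) \<alpha>"
        unfolding excess_def by (intro sum.cong) auto
      then show "excess (\<lambda>i. - d i) \<alpha> \<le> excess (\<lambda>i. - l' i) \<alpha>"
        using le(2)[OF \<alpha>] by simp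
    next
      have "l' i = 0 \<longleftrightarrow> i \<in> Z0" for i
        using sgn_l'[of i] zeros(2) by auto
      then have "{i. l' i = 0} = Z0" by blast
      with zeros(1) show "bij_betw f {i. d i = 0} {i. l' i = 0}" by simp
    qed
    ultimately show ?thesis by (rule diagonal_move_trans)
  qed (use a gap(2) in simp_all)
qed

text \<open>A zero of \<open>d\<close> need not come from a zero of \<open>l\<close>, since it can
  be mixed from entries of opposite sign. Spreading out all zeros of \<open>d\<close> uses at most
  half of each gap; what remains of the positive gap absorbs all zeros of \<open>l\<close>, so no
  zeros have to be matched.\<close>

lemma diagonal_move_two_gaps:
  fixes E :: "'h::complex_inner \<Rightarrow> 'h" and l d :: "nat \<Rightarrow> real"
  assumes sa: "selfadjoint_operator E" and l: "l \<longlonglongrightarrow> 0" and d: "d \<longlonglongrightarrow> 0"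
    and unb: "excess_unbounded d" "excess_unbounded (\<lambda>i. - d i)"
    and le: "\<And>\<alpha>. 0 < \<alpha> \<Longrightarrow> excess d \<alpha> \<le> excess l \<alpha>"
      "\<And>\<alpha>. 0 < \<alpha> \<Longrightarrow> excess (\<lambda>i. - d i) \<alpha> \<le> excess (\<lambda>i. - l i) \<alpha>"
    and gap: "excess_gap s l d" "excess_gap s (\<lambda>i. - l i) (\<lambda>i. - d i)" "0 < s"
  shows "diagonal_move E UNIV l UNIV d"
proof -
  obtain a1 where a1: "0 < a1" "\<And>\<alpha>. 0 < \<alpha> \<Longrightarrow> \<alpha> \<le> a1 \<Longrightarrow> s + excess d \<alpha> \<le> excess l \<alpha>"
    using gap(1) by (auto simp: excess_gap_def)
  obtain a2 where a2: "0 < a2"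
    "\<And>\<alpha>. 0 < \<alpha> \<Longrightarrow> \<alpha> \<le> a2 \<Longrightarrow> s + excess (\<lambda>i. - d i) \<alpha> \<le> excess (\<lambda>i. - l i) \<alpha>"
    using gap(2) by (auto simp: excess_gap_def)
  define a where "a = min a1 a2"
  have a: "0 < a" using a1 a2 by (simp add: a_def)
  show ?thesis
  proof (rule eliminate_zeros[OF d excess_unbounded_infinite[OF unb(1)], of "{i. d i = 0}" a "s / 2" "-1"])
    fix \<phi> d'
    assume \<phi>: "\<And>i. \<phi> (\<phi> i) = i" "\<And>i. d i + d (\<phi> i) = d' i + d' (\<phi> i)"
        "(-1::real) = -1 \<Longrightarrow> \<forall>i. min (d' i) (d' (\<phi> i)) \<le> d i \<and> d i \<le> max (d' i) (d' (\<phi> i))"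
      and d'0: "d' \<longlonglongrightarrow> 0"
      and signs: "\<And>i. 0 < d i \<Longrightarrow> 0 < d' i" "\<And>i. d i < 0 \<Longrightarrow> d' i = d i"
        "\<And>i. i \<in> {i. d i = 0} \<Longrightarrow> 0 < -1 * d' i"
      and near: "\<And>\<alpha>. 0 < \<alpha> \<Longrightarrow> \<bar>excess d' \<alpha> - excess d \<alpha>\<bar> \<le> (if \<alpha> \<le> a then s / 2 else 0)"
        "\<And>\<alpha>. 0 < \<alpha> \<Longrightarrow> \<bar>excess (\<lambda>i. - d' i) \<alpha> - excess (\<lambda>i. - d i) \<alpha>\<bar> \<le> (if \<alpha> \<le> a then s / 2 else 0)"
    have "diagonal_move E UNIV d' UNIV d"
      using \<phi> by (intro diagonal_move_involution[OF sa \<phi>(1)]) auto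
    moreover have "diagonal_move E UNIV l UNIV d'"
    proof (rule diagonal_move_one_gap[OF sa l d'0])
      have lim: "\<bar>excess d' \<alpha> - excess d \<alpha>\<bar> \<le> s / 2"
          "\<bar>excess (\<lambda>i. - d' i) \<alpha> - excess (\<lambda>i. - d i) \<alpha>\<bar> \<le> s / 2" if "0 < \<alpha>" for \<alpha>
        using near[OF that] gap(3) by (auto split: if_splits)
      show "excess_unbounded d'"
        using lim(1) by (intro excess_unbounded_perturb[OF unb(1), of _ "s / 2"]) (smt (verit))
      show "excess_unbounded (\<lambda>i. - d' i)"
        using lim(2) by (intro excess_unbounded_perturb[OF unb(2), of _ "s / 2"]) (smt (verit))
      show "excess d' \<alpha> \<le> excess l \<alpha>" if "0 < \<alpha>" for \<alpha>
      proof (cases "\<alpha> \<le> a")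
        case True
        then have "\<alpha> \<le> a1" by (simp add: a_def)
        then show ?thesis using lim(1)[OF that] a1(2)[OF that] gap(3) by linarith
      next
        case False
        then show ?thesis using near(1)[OF that] le(1)[OF that] by simp
      qed
      show "excess (\<lambda>i. - d' i) \<alpha> \<le> excess (\<lambda>i. - l i) \<alpha>" if "0 < \<alpha>" for \<alpha>
      proof (cases "\<alpha> \<le> a")
        case True
        then have "\<alpha> \<le> a2" by (simp add: a_def)
        then show ?thesis using lim(2)[OF that] a2(2)[OF that] gap(3) by linarith
      next
        case False
        then show ?thesis using near(2)[OF that] le(2)[OF that] by simp
      qed
      have "s / 2 + excess d' \<alpha> \<le> excess l \<alpha>" if "0 < \<alpha>" "\<alpha> \<le> a1" for \<alpha>
        using lim(1)[OF that(1)] a1(2)[OF that] by linarith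
      then show "excess_gap (s / 2) l d'"
        using a1(1) by (auto simp: excess_gap_def)
      show "0 < s / 2" using gap(3) by simp
      have "d' i \<noteq> 0" for i
        using signs[of i] by (cases "d i" "0::real" rule: linorder_cases) simp_all
      then show "bij_betw id {i. d' i = 0} {}" by simp
    qed simp
    ultimately show ?thesis by (meson diagonal_move_trans)
  qed (use a gap(3) in simp_all)
qed

text \<open>The sums of \<open>d\<close> may converge here, so the chains are not applied to
  \<open>d\<close> itself but used for a \<open>d'\<close> with both sums divergent, whose pairs are
  then mixed back to \<open>d\<close>.\<close>

lemma diagonal_move_infinite_gaps:
  fixes E :: "'h::complex_inner \<Rightarrow> 'h" and l d :: "nat \<Rightarrow> real"
  assumes sa: "selfadjoint_operator E" and l: "l \<longlonglongrightarrow> 0" and d: "d \<longlonglongrightarrow> 0"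
    and le: "\<And>\<alpha>. 0 < \<alpha> \<Longrightarrow> excess d \<alpha> \<le> excess l \<alpha>"
      "\<And>\<alpha>. 0 < \<alpha> \<Longrightarrow> excess (\<lambda>i. - d i) \<alpha> \<le> excess (\<lambda>i. - l i) \<alpha>"
    and gap: "\<And>s. excess_gap s l d" "\<And>s. excess_gap s (\<lambda>i. - l i) (\<lambda>i. - d i)"
  shows "diagonal_move E UNIV l UNIV d"
proof (rule pull_pairs_apart[OF d le gap[unfolded excess_gap_def]])
  fix \<phi> d'
  assume \<phi>: "\<And>i. \<phi> (\<phi> i) = i" "\<And>i. d' i + d' (\<phi> i) = d i + d (\<phi> i)"
      "\<And>i. min (d' i) (d' (\<phi> i)) \<le> d i" "\<And>i. d i \<le> max (d' i) (d' (\<phi> i))"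
    and d': "d' \<longlonglongrightarrow> 0"
    and le': "\<And>\<alpha>. 0 < \<alpha> \<Longrightarrow> excess d' \<alpha> \<le> excess l \<alpha>"
      "\<And>\<alpha>. 0 < \<alpha> \<Longrightarrow> excess (\<lambda>i. - d' i) \<alpha> \<le> excess (\<lambda>i. - l i) \<alpha>"
    and gap': "\<exists>a>0. \<forall>\<alpha>. 0 < \<alpha> \<and> \<alpha> \<le> a \<longrightarrow> 1 + excess d' \<alpha> \<le> excess l \<alpha>"
      "\<exists>a>0. \<forall>\<alpha>. 0 < \<alpha> \<and> \<alpha> \<le> a \<longrightarrow> 1 + excess (\<lambda>i. - d' i) \<alpha> \<le> excess (\<lambda>i. - l i) \<alpha>"
    and unb': "excess_unbounded d'" "excess_unbounded (\<lambda>i. - d' i)"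
  have "diagonal_move E UNIV l UNIV d'"
    using gap' by (intro diagonal_move_two_gaps[OF sa l d' unb' le', of 1]) (auto simp: excess_gap_def)
  also have "diagonal_move E UNIV d' UNIV d"
    using \<phi> by (intro diagonal_move_involution[OF sa \<phi>(1)]) auto
  finally (diagonal_move_trans) show ?thesis .
qed

section \<open>From \<open>delta\<close>, sums and lower limits to excess gaps\<close>

lemma delta_excess: "0 < \<alpha> \<Longrightarrow> delta \<alpha> l d = excess l \<alpha> - excess d \<alpha>"
  by (simp add: delta_def excess_def)

lemma delta_uminus: "\<alpha> \<noteq> 0 \<Longrightarrow> delta (- \<alpha>) l d = delta \<alpha> (\<lambda>i. - l i) (\<lambda>i. - d i)"
  by (cases "0 < \<alpha>")
    (simp_all add: delta_def le_minus_iff minus_le_iff minus_diff_commute add.commute)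

lemma neg_sum_eq: "neg_sum c = pos_sum (\<lambda>i. - c i)"
  unfolding neg_sum_def pos_sum_def by (intro infsum_cong_neutral) auto

lemma sigma_minus_eq: "sigma_minus l d = sigma_plus (\<lambda>i. - l i) (\<lambda>i. - d i)"
proof -
  have "Liminf (at_left (0::real)) f = Liminf (at_right 0) (\<lambda>\<alpha>. f (- \<alpha>))" for f :: "real \<Rightarrow> ereal"
    using Liminf_filtermap_le[of uminus "at_right (0::real)" f]
      Liminf_filtermap_ge[of uminus "at_right (0::real)" f]
    by (simp add: at_left_minus[of "0::real"])
  moreover have "Liminf (at_right 0) (\<lambda>\<alpha>. ereal (delta (- \<alpha>) l d))
      = Liminf (at_right 0) (\<lambda>\<alpha>. ereal (delta \<alpha> (\<lambda>i. - l i) (\<lambda>i. - d i)))"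
    by (intro Liminf_eq) (auto simp: delta_uminus eventually_at_right_field intro!: exI[of _ 1])
  ultimately show ?thesis
    unfolding sigma_minus_def sigma_plus_def by simp
qed

lemma sigma_plus_gap:
  assumes "ereal s < sigma_plus l d"
  shows "excess_gap s l d"
proof -
  have "\<forall>\<^sub>F \<alpha> in at_right 0. ereal s < ereal (delta \<alpha> l d)"
    using assms unfolding sigma_plus_def by (rule less_LiminfD)
  then obtain b where "0 < b" "\<And>\<alpha>. 0 < \<alpha> \<Longrightarrow> \<alpha> < b \<Longrightarrow> s < delta \<alpha> l d"
    by (auto simp: eventually_at_right_field)
  then show ?thesis
    unfolding excess_gap_def by (intro exI[of _ "b / 2"]) (force simp: delta_excess)
qed

lemma gap_sigma_plus:
  assumes "excess_gap s l d"
  shows "ereal s \<le> sigma_plus l d"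
proof -
  obtain a where "0 < a" "\<And>\<alpha>. 0 < \<alpha> \<Longrightarrow> \<alpha> \<le> a \<Longrightarrow> s + excess d \<alpha> \<le> excess l \<alpha>"
    using assms by (auto simp: excess_gap_def)
  then show ?thesis
    unfolding sigma_plus_def
    by (intro Liminf_bounded) (force simp: eventually_at_right_field delta_excess)
qed

lemma pos_sum_infinite:
  assumes c: "c \<longlonglongrightarrow> 0" and "pos_sum c = \<infinity>"
  shows "excess_unbounded c"
  unfolding excess_unbounded_def
proof
  fix C :: real
  have "pos_sum c = (SUP F\<in>{F. finite F \<and> F \<subseteq> {i. 0 < c i}}. \<Sum>i\<in>F. ennreal (c i))"
    unfolding pos_sum_def by (rule nonneg_infsum_complete) simp
  then have "ennreal (\<bar>C\<bar> + 1) < (SUP F\<in>{F. finite F \<and> F \<subseteq> {i. 0 < c i}}. \<Sum>i\<in>F. ennreal (c i))"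
    using assms(2) by (simp add: ennreal_less_top)
  then obtain F where F: "finite F" "F \<subseteq> {i. 0 < c i}" "ennreal (\<bar>C\<bar> + 1) < (\<Sum>i\<in>F. ennreal (c i))"
    by (auto simp: less_SUP_iff)
  have "(\<Sum>i\<in>F. ennreal (c i)) = ennreal (\<Sum>i\<in>F. c i)"
    using F(2) by (intro sum_ennreal) auto
  then have sum: "\<bar>C\<bar> + 1 < (\<Sum>i\<in>F. c i)"
    using F(3) ennreal_less_iff[of "\<bar>C\<bar> + 1"] by simp
  \<comment> \<open>So small that subtracting it from every member of \<open>F\<close> costs at most
    the 1 set aside above.\<close>
  define \<alpha> where "\<alpha> = 1 / real (Suc (card F))"
  have \<alpha>: "0 < \<alpha>" "real (card F) * \<alpha> \<le> 1" by (auto simp: \<alpha>_def field_simps)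
  have "C < (\<Sum>i\<in>F. c i - \<alpha>)"
    using sum \<alpha>(2) by (simp add: sum_subtractf)
  also have "\<dots> \<le> excess c \<alpha>"
    by (intro excess_ge c \<alpha> F)
  finally show "\<exists>\<alpha>>0. C < excess c \<alpha>" using \<alpha> by blast
qed

lemma pos_sum_finite:
  assumes c: "c \<longlonglongrightarrow> 0" and "pos_sum c \<noteq> \<infinity>"
  shows "\<exists>C. \<forall>\<alpha>>0. excess c \<alpha> \<le> C"
proof (intro exI allI impI)
  fix \<alpha> :: real assume \<alpha>: "0 < \<alpha>"
  have "ennreal (\<Sum>i | \<alpha> \<le> c i. c i) = (\<Sum>i | \<alpha> \<le> c i. ennreal (c i))"
    using \<alpha> by (intro sum_ennreal[symmetric]) auto
  also have "\<dots> \<le> pos_sum c"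
    unfolding pos_sum_def using \<alpha> finite_level[OF c \<alpha>]
    by (subst nonneg_infsum_complete) (auto intro!: SUP_upper)
  finally have "(\<Sum>i | \<alpha> \<le> c i. c i) \<le> enn2real (pos_sum c)"
    using assms(2) by (metis enn2real_leI enn2real_nonneg ennreal_enn2real ennreal_le_iff infinity_ennreal_def less_top)
  moreover have "excess c \<alpha> \<le> (\<Sum>i | \<alpha> \<le> c i. c i)"
    unfolding excess_def using \<alpha> by (intro sum_mono) auto
  ultimately show "excess c \<alpha> \<le> enn2real (pos_sum c)" by linarith
qed

text \<open>The positive sum of \<open>d\<close> bounds \<open>excess d\<close> uniformly, while
  \<open>excess l\<close> exceeds any bound at some level and, being antitone, at all smaller
  ones.\<close>

lemma infinite_gap:
  assumes l: "l \<longlonglongrightarrow> 0" and d: "d \<longlonglongrightarrow> 0" and "pos_sum l = \<infinity>" "pos_sum d \<noteq> \<infinity>"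
  shows "excess_gap s l d"
proof -
  obtain C where C: "\<And>\<alpha>. 0 < \<alpha> \<Longrightarrow> excess d \<alpha> \<le> C"
    using pos_sum_finite[OF d assms(4)] by blast
  obtain a where "0 < a" "s + C < excess l a"
    using pos_sum_infinite[OF l assms(3)] unfolding excess_unbounded_def by blast
  then show ?thesis
    unfolding excess_gap_def using C excess_antimono[OF l] by (intro exI[of _ a]) (smt (verit))
qed

lemma infinite_sigma_plus_gap: "sigma_plus l d = \<infinity> \<Longrightarrow> excess_gap s l d"
  by (rule sigma_plus_gap) simp

text \<open>Infinite sets of natural numbers are all equinumerous, so \<open>ecard\<close> retains
  enough information to produce an embedding.\<close>

lemma embed_zeros:
  fixes A B :: "nat set"
  assumes "ecard B \<le> ecard A"
  obtains f A0 where "bij_betw f B A0" "A0 \<subseteq> A"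
proof (cases "finite B")
  case True
  have "\<exists>A0\<subseteq>A. finite A0 \<and> card A0 = card B"
  proof (cases "finite A")
    case fin: True
    then have "card B \<le> card A" using assms True by (simp add: ecard_def)
    then show ?thesis by (metis fin finite_subset obtain_subset_with_card_n)
  next
    case False
    then show ?thesis using infinite_arbitrarily_large[of A "card B"] by blast
  qed
  then show ?thesis
    using True finite_same_card_bij that by metis
next
  case False
  then have "infinite A"
    using assms by (auto simp: ecard_def split: if_splits)
  then have "bij_betw (enumerate A \<circ> inv_into UNIV (enumerate B)) B A"
    using False by (intro bij_betw_trans[OF bij_betw_inv_into[OF bij_enumerate] bij_enumerate])
  then show ?thesis using that by blast
qed

lemma diagonal_move_one_sigma:
  fixes E :: "'h::complex_inner \<Rightarrow> 'h" and l d :: "nat \<Rightarrow> real"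
  assumes sa: "selfadjoint_operator E" and l: "l \<longlonglongrightarrow> 0" and d: "d \<longlonglongrightarrow> 0"
    and sums: "pos_sum d = \<infinity>" "neg_sum d = \<infinity>"
    and le: "\<And>\<alpha>. 0 < \<alpha> \<Longrightarrow> excess d \<alpha> \<le> excess l \<alpha>"
      "\<And>\<alpha>. 0 < \<alpha> \<Longrightarrow> excess (\<lambda>i. - d i) \<alpha> \<le> excess (\<lambda>i. - l i) \<alpha>"
    and "0 < sigma_plus l d" and zeros: "ecard {i. d i = 0} \<le> ecard {i. l i = 0}"
  shows "diagonal_move E UNIV l UNIV d"
proof -
  obtain s where s: "0 < ereal s" "ereal s < sigma_plus l d"
    using ereal_dense2[OF \<open>0 < sigma_plus l d\<close>] by blast
  obtain f Z0 where f: "bij_betw f {i. d i = 0} Z0" "Z0 \<subseteq> {i. l i = 0}"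
    using embed_zeros[OF zeros] by blast
  have "(\<lambda>i. - d i) \<longlonglongrightarrow> 0"
    using tendsto_minus[OF d] by simp
  then have "excess_unbounded d" "excess_unbounded (\<lambda>i. - d i)"
    using sums d by (auto simp: neg_sum_eq intro: pos_sum_infinite)
  then show ?thesis
    using s f by (intro diagonal_move_one_gap[OF sa l d _ _ le sigma_plus_gap[OF s(2)] _ f]) auto
qed

theorem theorem9p1:
  fixes l d :: "nat \<Rightarrow> real"
    and E :: "'h::complex_hilbert_space \<Rightarrow> 'h"
  assumes "l \<longlonglongrightarrow> 0" and "d \<longlonglongrightarrow> 0"
    and "neg_sum l = \<infinity>" and "pos_sum l = \<infinity>"
    and "\<And>\<alpha>. \<alpha> \<noteq> 0 \<Longrightarrow> delta \<alpha> l d \<ge> 0"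
    and a: "sigma_minus l d + sigma_plus l d > 0"
    and b: "sigma_minus l d = 0 \<or> sigma_plus l d = 0 \<Longrightarrow>
              ecard {i. l i = 0} \<ge> ecard {i. d i = 0}"
    and c: "pos_sum d = \<infinity> \<or> sigma_minus l d = \<infinity>"
    and d: "neg_sum d = \<infinity> \<or> sigma_plus l d = \<infinity>"
    and "separable_space (euclidean :: 'h topology)"
    and "selfadjoint_operator E" and "is_diagonal l E"
  shows "is_diagonal d E"
proof -
  note l0 = \<open>l \<longlonglongrightarrow> 0\<close> and d0 = \<open>d \<longlonglongrightarrow> 0\<close> and sa = \<open>selfadjoint_operator E\<close>
  let ?l = "\<lambda>i. - l i" and ?d = "\<lambda>i. - d i"
  have m0: "?l \<longlonglongrightarrow> 0" "?d \<longlonglongrightarrow> 0"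
    using tendsto_minus[OF l0] tendsto_minus[OF d0] by simp_all
  have le: "excess d \<alpha> \<le> excess l \<alpha>" "excess ?d \<alpha> \<le> excess ?l \<alpha>" if "0 < \<alpha>" for \<alpha>
    using assms(5)[of \<alpha>] assms(5)[of "- \<alpha>"] that delta_uminus[of \<alpha> l d]
    by (simp_all add: delta_excess)
  have "excess_gap 0 l d" "excess_gap 0 ?l ?d"
    unfolding excess_gap_def using le by (intro exI[of _ 1]; simp)+
  then have nonneg: "0 \<le> sigma_plus l d" "0 \<le> sigma_minus l d"
    using gap_sigma_plus by (auto simp: sigma_minus_eq zero_ereal_def)
  have finite_sum: "pos_sum d \<noteq> \<infinity> \<Longrightarrow> excess_gap s l d"
    "neg_sum d \<noteq> \<infinity> \<Longrightarrow> excess_gap s ?l ?d" for s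
    using assms(3,4) infinite_gap[OF l0 d0] infinite_gap[OF m0] by (auto simp: neg_sum_eq)
  have pos_sum_of_zero: "pos_sum d = \<infinity>" if "sigma_plus l d = 0"
    using finite_sum(1)[of 1] gap_sigma_plus[of 1 l d] that by (auto simp: zero_ereal_def)
  have neg_sum_of_zero: "neg_sum d = \<infinity>" if "sigma_minus l d = 0"
    using finite_sum(2)[of 1] gap_sigma_plus[of 1 ?l ?d] that by (auto simp: zero_ereal_def sigma_minus_eq)
  have "diagonal_move E UNIV l UNIV d"
  proof (cases "pos_sum d = \<infinity> \<and> neg_sum d = \<infinity>")
    case True
    then have sums: "pos_sum d = \<infinity>" "neg_sum d = \<infinity>" by auto
    show ?thesis
    \<comment> \<open>A side whose lower limit is 0 offers no guaranteed room for trading zeros;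
      there (b) allows every zero of \<open>d\<close> to be taken from a zero of
      \<open>l\<close>.\<close>
    proof (cases "sigma_minus l d = 0 \<or> sigma_plus l d = 0")
      case zero: True
      note zeros = b[OF zero]
      show ?thesis
      proof (cases "sigma_plus l d = 0")
        case False
        then show ?thesis
          using nonneg zeros by (intro diagonal_move_one_sigma[OF sa l0 d0 sums le]) auto
      next
        case True
        \<comment> \<open>By (a) the room is on the negative side, which passing to
          \<open>- E\<close> turns into the positive one.\<close>
        then have "0 < sigma_plus ?l ?d"
          using a nonneg by (simp add: sigma_minus_eq)
        then have "diagonal_move (\<lambda>x. - E x) UNIV ?l UNIV ?d"
          using sums zeros le
          by (intro diagonal_move_one_sigma[OF selfadjoint_uminus[OF sa] m0]) (auto simp: neg_sum_eq)
        then show ?thesis by (rule diagonal_move_uminus)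
      qed
    next
      case False
      then have "0 < min (sigma_minus l d) (sigma_plus l d)"
        using nonneg by (auto simp: less_le min_def split: if_splits)
      then obtain s where s: "0 < ereal s" "ereal s < min (sigma_minus l d) (sigma_plus l d)"
        using ereal_dense2 by blast
      then have "excess_gap s l d" "excess_gap s ?l ?d"
        by (auto intro: sigma_plus_gap simp flip: sigma_minus_eq)
      moreover have "excess_unbounded d" "excess_unbounded ?d"
        using sums d0 m0 by (auto simp: neg_sum_eq intro: pos_sum_infinite)
      ultimately show ?thesis
        using s by (intro diagonal_move_two_gaps[OF sa l0 d0 _ _ le, of s]) auto
    qed
  next
    case False
    \<comment> \<open>A side on which the sum of \<open>d\<close> converges has gaps of every size
      because that of \<open>l\<close> diverges; (c) or (d) then makes the gaps on the opposite side
      infinite as well.\<close>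
    then have "excess_gap s l d" "excess_gap s ?l ?d" for s
      using c d finite_sum[of s] infinite_sigma_plus_gap[of l d s] infinite_sigma_plus_gap[of ?l ?d s]
      by (auto simp: sigma_minus_eq)
    then show ?thesis
      by (intro diagonal_move_infinite_gaps[OF sa l0 d0 le])
  qed
  then show ?thesis
    using \<open>is_diagonal l E\<close> by (rule is_diagonal_move)
qed

end
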